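(* Suppose $\alpha\in(\alpha_*,1)$ and $\Delta:=1-\alpha F'(u_* )>0$. Let $q_*=1-p_*$. Then, almost surely, $$\limsup_{n\to\infty}\frac{R_n-np_*}{\sqrt{n\log\log n}}=\frac{\sqrt{2p_*q_*}}{\Delta}\qquad\text{and}\qquad \limsup_{n\to\infty}\,-\frac{R_n-np_*}{\sqrt{n\log\log n}}=\frac{\sqrt{2p_*q_*}}{\Delta}.$$ Furthermore, $$\mathrm{power}_n=\frac{R_n}{n}\left(\frac{1-\alpha}{\pi}+\alpha\right)+o_p(1),\qquad\text{and}\qquad \mathrm{power}_n\to G(u_* )\ \text{ almost surely.}$$
   Context: Random effects model: $\pi\in(0,1)$ is fixed; $(p_1,\theta_1),(p_2,\theta_2),\ldots$ is an infinite i.i.d. sequence, $\theta_j\in\{0,1\}$ with $\Pr\{\theta_j=1\}=\pi$ ($\theta_j=1$ means that the $j$th null is false), and for $u\in[0,1]$, $\Pr\{p_j\le u\mid\theta_j=0\}=u$ and $\Pr\{p_j\le u\mid\theta_j=1\}=G(u)$. The common distribution function of the $p$-values is $F(u)=(1-\pi)u+\pi G(u)$; it is assumed that $F$ is continuous on $[0,1]$ with $F(0)=0$ (and differentiable at $u_*$ below, so that $F'(u_* )$ makes sense). Put $\alpha_*=\inf_{0<u\le 1}u/F(u)$, and, for the given $\alpha$, $u_*=\max\{u\in[0,1]:u/\alpha\le F(u)\}$ and $p_*=F(u_* )=u_*/\alpha$. Benjamini–Hochberg (BH) procedure at target level $\alpha$ applied, for each $n$, to the first $n$ $p$-values $p_1,\ldots,p_n$: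 let $p_{n:1}\le\cdots\le p_{n:n}$ be the order statistics, $p_{n:0}=0$, and $R_n=\max\{j\in\{0,\dots,n\}:p_{n:j}\le\alpha j/n\}$. The nulls with $p$-values $\le p_{n:R_n}$ are rejected. $V_n=\#\{j\le n:p_j\le p_{n:R_n},\ \theta_j=0\}$ is the number of false rejections. With $N=\#\{j\le n:\theta_j=0\}$, $\mathrm{power}_n=(R_n-V_n)/((n-N)\vee 1)$. *)

theory Defs
  imports "HOL-Probability.Probability"
begin

text \<open>
  The sequence is indexed from 0, so \<open>p j\<close>, \<open>\<theta> j\<close> stand for the \<open>(j+1)\<close>-st pair and the
  first \<open>n\<close> hypotheses are those with \<open>j < n\<close>.  \<open>\<theta> j \<omega>\<close> holds iff \<open>\<theta>\<^sub>j = 1\<close>, i.e. iff the null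
  is false.
\<close>

locale random_effects_model = prob_space M for M :: "'a measure" +
  fixes \<pi> :: real and G :: "real \<Rightarrow> real"
    and p :: "nat \<Rightarrow> 'a \<Rightarrow> real" and \<theta> :: "nat \<Rightarrow> 'a \<Rightarrow> bool"
  assumes pi_range: "0 < \<pi>" "\<pi> < 1"
    and indep: "indep_vars (\<lambda>_. borel \<Otimes>\<^sub>M count_space UNIV) (\<lambda>j \<omega>. (p j \<omega>, \<theta> j \<omega>)) UNIV"
    and ident: "\<And>j. distr M (borel \<Otimes>\<^sub>M count_space UNIV) (\<lambda>\<omega>. (p j \<omega>, \<theta> j \<omega>))
                   = distr M (borel \<Otimes>\<^sub>M count_space UNIV) (\<lambda>\<omega>. (p 0 \<omega>, \<theta> 0 \<omega>))"
    and p_range: "\<And>j. AE \<omega> in M. p j \<omega> \<in> {0..1}"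
    and prob_false_null: "\<And>j. \<P>(\<omega> in M. \<theta> j \<omega>) = \<pi>"
    and null_cdf: "\<And>j u. u \<in> {0..1} \<Longrightarrow> \<P>(\<omega> in M. p j \<omega> \<le> u \<bar> \<not> \<theta> j \<omega>) = u"
    and alt_cdf: "\<And>j u. u \<in> {0..1} \<Longrightarrow> \<P>(\<omega> in M. p j \<omega> \<le> u \<bar> \<theta> j \<omega>) = G u"

definition mixture_cdf :: "real \<Rightarrow> (real \<Rightarrow> real) \<Rightarrow> real \<Rightarrow> real" where
  "mixture_cdf \<pi> G u = (1 - \<pi>) * u + \<pi> * G u"

text \<open>Taken in \<^typ>\<open>ereal\<close> so that \<open>u / F u = \<infinity>\<close> (and not 0) when \<open>F u = 0\<close>.\<close>

definition alpha_star :: "(real \<Rightarrow> real) \<Rightarrow> ereal" where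
  "alpha_star F = (INF u\<in>{0<..1}. ereal u / ereal (F u))"

definition u_star :: "(real \<Rightarrow> real) \<Rightarrow> real \<Rightarrow> real" where
  "u_star F \<alpha> = (GREATEST u. u \<in> {0..1} \<and> u / \<alpha> \<le> F u)"

definition p_star :: "(real \<Rightarrow> real) \<Rightarrow> real \<Rightarrow> real" where
  "p_star F \<alpha> = F (u_star F \<alpha>)"

text \<open>
  The Benjamini-Hochberg procedure for fixed p-values \<open>x 0, \<dots>, x (n - 1)\<close> and truth values
  \<open>t 0, \<dots>, t (n - 1)\<close>.
\<close>

definition order_stat :: "(nat \<Rightarrow> real) \<Rightarrow> nat \<Rightarrow> nat \<Rightarrow> real" where
  "order_stat x n j = (if j = 0 then 0 else sort (map x [0..<n]) ! (j - 1))"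

definition bh_rejections :: "real \<Rightarrow> (nat \<Rightarrow> real) \<Rightarrow> nat \<Rightarrow> nat" where
  "bh_rejections \<alpha> x n = Max {j \<in> {0..n}. order_stat x n j \<le> \<alpha> * real j / real n}"

definition bh_false_rejections ::
  "real \<Rightarrow> (nat \<Rightarrow> real) \<Rightarrow> (nat \<Rightarrow> bool) \<Rightarrow> nat \<Rightarrow> nat" where
  "bh_false_rejections \<alpha> x t n =
     card {j. j < n \<and> x j \<le> order_stat x n (bh_rejections \<alpha> x n) \<and> \<not> t j}"

definition num_true_nulls :: "(nat \<Rightarrow> bool) \<Rightarrow> nat \<Rightarrow> nat" where
  "num_true_nulls t n = card {j. j < n \<and> \<not> t j}"

definition bh_power :: "real \<Rightarrow> (nat \<Rightarrow> real) \<Rightarrow> (nat \<Rightarrow> bool) \<Rightarrow> nat \<Rightarrow> real" where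
  "bh_power \<alpha> x t n =
     (real (bh_rejections \<alpha> x n) - real (bh_false_rejections \<alpha> x t n))
       / real (max (n - num_true_nulls t n) 1)"

text \<open>Convergence to 0 in probability, \<open>X n = o\<^sub>p(1)\<close>.\<close>

definition (in prob_space) small_o_p_1 :: "(nat \<Rightarrow> 'a \<Rightarrow> real) \<Rightarrow> bool" where
  "small_o_p_1 X \<longleftrightarrow> (\<forall>n. random_variable borel (X n)) \<and>
     (\<forall>\<epsilon>>0. (\<lambda>n. \<P>(\<omega> in M. \<bar>X n \<omega>\<bar> > \<epsilon>)) \<longlonglongrightarrow> 0)"

end

theory Submission
  imports Defs "HOL-Real_Asymp.Real_Asymp"
begin

text \<open>
  Write \<open>N\<^sub>n(u)\<close> for the number of p-values \<open>\<le> u\<close> among the first \<open>n\<close>.  The BH procedure only looks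
  at the grid \<open>\<alpha> j / n\<close>: \<open>R\<^sub>n\<close> is the largest \<open>j \<le> n\<close> with \<open>N\<^sub>n(\<alpha> j / n) \<ge> j\<close>, and at the
  threshold \<open>u\<^sub>n = \<alpha> R\<^sub>n / n\<close> this is an equality, \<open>N\<^sub>n(u\<^sub>n) = R\<^sub>n\<close>.  So \<open>u\<^sub>n\<close> is the last crossing of
  the empirical distribution function with the line \<open>u / \<alpha>\<close>, while \<open>u\<^sub>*\<close> is the last crossing of \<open>F\<close>
  with that line.  Since \<open>u\<^sub>* = \<alpha> p\<^sub>*\<close>, subtracting the two crossing equations gives

    \<open>R\<^sub>n - n p\<^sub>* = (N\<^sub>n(u\<^sub>*) - n p\<^sub>*) + n (F(u\<^sub>n) - F(u\<^sub>*)) + e\<^sub>n\<close>,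

  where \<open>e\<^sub>n\<close> is the increment of the centred count between \<open>u\<^sub>*\<close> and \<open>u\<^sub>n\<close>.  The middle term is
  \<open>(\<alpha> F'(u\<^sub>*) + o(1)) (R\<^sub>n - n p\<^sub>*)\<close>, hence
  \<open>R\<^sub>n - n p\<^sub>* = (N\<^sub>n(u\<^sub>*) - n p\<^sub>* + e\<^sub>n) / (\<Delta> + o(1))\<close>.  The leading term is a binomial random walk with
  step variance \<open>p\<^sub>* q\<^sub>*\<close>, to which the law of the iterated logarithm applies.

  It remains to see that \<open>u\<^sub>n \<longlonglongrightarrow> u\<^sub>*\<close> and that \<open>e\<^sub>n\<close> is negligible.  As \<open>u\<^sub>n\<close> lies on a grid of \<open>n + 1\<close>
  points, both follow from an exponential inequality, a union bound over the grid and Borel-Cantelli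
  (\<open>uniform_deviation\<close>).  A first application bounds \<open>N\<^sub>n - n F\<close> on the grid by
  \<open>n\<^sup>3\<^sup>/\<^sup>5\<close>, and transversality of the crossing (\<open>\<Delta> > 0\<close>) turns this into
  \<open>u\<^sub>n - u\<^sub>* = O(n\<^sup>-\<^sup>2\<^sup>/\<^sup>5)\<close>.  For every grid point that close to \<open>u\<^sub>*\<close>, the centred increment
  is a sum of \<open>n\<close> terms whose variance has order \<open>n\<^sup>-\<^sup>2\<^sup>/\<^sup>5\<close>, and a second application, localised near
  \<open>u\<^sub>*\<close>, gives \<open>\<bar>e\<^sub>n\<bar> \<le> n\<^sup>1\<^sup>7\<^sup>/\<^sup>4\<^sup>0\<close>, which is \<open>o(\<surd>n)\<close>.

  The law of the iterated logarithm is proved for bounded i.i.d. variables.  The upper half is the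
  usual combination of an exponential maximal inequality with Borel-Cantelli along a geometric
  sequence of times.  The lower half needs a lower bound for the probability of moderate
  deviations; it is obtained by splitting a block of time into about \<open>c ln k\<close> sub-blocks and asking
  each of them to be large, which by the central limit theorem has a probability bounded below.

  For the power, the same grid bound applied to the false nulls shows that the number of correct
  rejections divided by \<open>n\<close> tends to \<open>\<pi> G(u\<^sub>*)\<close>, while the number of false nulls divided by \<open>n\<close> tends
  to \<open>\<pi>\<close>.  The limit \<open>G(u\<^sub>*)\<close> equals \<open>p\<^sub>* ((1 - \<alpha>) / \<pi> + \<alpha>)\<close> by the crossing equation, and
  \<open>R\<^sub>n / n \<longlonglongrightarrow> p\<^sub>*\<close>, so the remainder in the expansion of the power even tends to 0 almost surely.
\<close>

section \<open>Exponential inequalities for bounded i.i.d. sums\<close>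

lemma exp_le_quadratic:
  fixes y :: real
  shows "exp y \<le> 1 + y + y\<^sup>2 / 2 * exp \<bar>y\<bar>"
proof -
  obtain t where t: "\<bar>t\<bar> \<le> \<bar>y\<bar>" "exp y = (\<Sum>m<2. y ^ m / fact m) + exp t / fact 2 * y ^ 2"
    using Maclaurin_exp_le[of y 2] by blast
  have "exp t * (y\<^sup>2 / 2) \<le> exp \<bar>y\<bar> * (y\<^sup>2 / 2)"
    by (intro mult_right_mono) (use t in auto)
  then show ?thesis using t(2) by (simp add: eval_nat_numeral algebra_simps)
qed

locale bounded_centred_iid = prob_space M for M :: "'a measure" +
  fixes X :: "nat \<Rightarrow> 'a \<Rightarrow> real" and b :: real
  assumes indep: "indep_vars (\<lambda>_. borel) X UNIV"
    and ident: "distr M borel (X i) = distr M borel (X 0)"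
    and bounded: "\<omega> \<in> space M \<Longrightarrow> \<bar>X i \<omega>\<bar> \<le> b"
    and centred: "expectation (X 0) = 0"
begin

definition S :: "nat \<Rightarrow> 'a \<Rightarrow> real" where "S n \<omega> = (\<Sum>i<n. X i \<omega>)"

definition v :: real where "v = expectation (\<lambda>\<omega>. (X 0 \<omega>)\<^sup>2)"

lemma X_measurable [measurable]: "X i \<in> borel_measurable M"
  using indep by (auto simp: indep_vars_def)

lemma S_measurable [measurable]: "S n \<in> borel_measurable M"
  unfolding S_def by measurable

lemma b_nonneg: "0 \<le> b"
proof -
  obtain \<omega> where "\<omega> \<in> space M" using not_empty by blast
  from bounded[OF this, of 0] show ?thesis by linarith
qed

lemma v_nonneg: "0 \<le> v" unfolding v_def by simp

lemma integrable_bounded_function: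
  fixes f :: "'a \<Rightarrow> real"
  assumes [measurable]: "f \<in> borel_measurable M" and "\<And>\<omega>. \<omega> \<in> space M \<Longrightarrow> \<bar>f \<omega>\<bar> \<le> c"
  shows "integrable M f"
  by (rule integrable_const_bound[where B = c]) (use assms(2) in auto)

lemma integrable_X [simp]: "integrable M (X i)" and integrable_X_sq [simp]: "integrable M (\<lambda>\<omega>. (X i \<omega>)\<^sup>2)"
proof -
  show "integrable M (X i)" by (rule integrable_bounded_function[OF _ bounded]) auto
  show "integrable M (\<lambda>\<omega>. (X i \<omega>)\<^sup>2)"
  proof (rule integrable_bounded_function[where c = "b\<^sup>2"])
    show "\<bar>(X i \<omega>)\<^sup>2\<bar> \<le> b\<^sup>2" if "\<omega> \<in> space M" for \<omega>
      using bounded[OF that, of i] power2_le_iff_abs_le[OF b_nonneg] by auto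
  qed auto
qed

lemma expectation_transfer:
  fixes h :: "real \<Rightarrow> real"
  assumes [measurable]: "h \<in> borel_measurable borel"
  shows "expectation (\<lambda>\<omega>. h (X i \<omega>)) = expectation (\<lambda>\<omega>. h (X 0 \<omega>))"
  using integral_distr[of "X i" M borel h] integral_distr[of "X 0" M borel h] ident[of i] by simp

lemma expectation_X [simp]: "expectation (X i) = 0"
  using expectation_transfer[of "\<lambda>x. x" i] centred by simp

lemma expectation_X_sq: "expectation (\<lambda>\<omega>. (X i \<omega>)\<^sup>2) = v"
  using expectation_transfer[of "\<lambda>x. x\<^sup>2" i] by (simp add: v_def)

lemma abs_sum_X_le:
  assumes "\<omega> \<in> space M" "finite A"
  shows "\<bar>\<Sum>i\<in>A. X i \<omega>\<bar> \<le> card A * b"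
proof -
  have "\<bar>\<Sum>i\<in>A. X i \<omega>\<bar> \<le> (\<Sum>i\<in>A. \<bar>X i \<omega>\<bar>)" by (rule sum_abs)
  also have "\<dots> \<le> (\<Sum>i\<in>A. b)" by (intro sum_mono bounded assms)
  finally show ?thesis by simp
qed

lemma integrable_exp_sum [simp]:
  assumes "finite A"
  shows "integrable M (\<lambda>\<omega>. exp (s * (\<Sum>i\<in>A. X i \<omega>)))"
proof (rule integrable_bounded_function[where c = "exp (\<bar>s\<bar> * (card A * b))"])
  fix \<omega> assume "\<omega> \<in> space M"
  have "s * (\<Sum>i\<in>A. X i \<omega>) \<le> \<bar>s\<bar> * \<bar>\<Sum>i\<in>A. X i \<omega>\<bar>" by (metis abs_ge_self abs_mult)
  also have "\<dots> \<le> \<bar>s\<bar> * (card A * b)"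
    by (intro mult_left_mono abs_sum_X_le) (use \<open>\<omega> \<in> space M\<close> assms in auto)
  finally show "\<bar>exp (s * (\<Sum>i\<in>A. X i \<omega>))\<bar> \<le> exp (\<bar>s\<bar> * (card A * b))" by simp
qed auto

lemma integrable_exp_X [simp]: "integrable M (\<lambda>\<omega>. exp (s * X i \<omega>))"
  using integrable_exp_sum[of "{i}" s] by simp

text \<open>
  The constant \<open>1 / 2\<close> in front of \<open>s\<^sup>2 v\<close> decides the constant in the law of the iterated logarithm;
  the correction \<open>exp (\<bar>s\<bar> * b)\<close> tends to 1 because only small \<open>s\<close> will be used there.
\<close>

lemma mgf_X_le: "expectation (\<lambda>\<omega>. exp (s * X i \<omega>)) \<le> exp (s\<^sup>2 * v / 2 * exp (\<bar>s\<bar> * b))"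
proof -
  have "expectation (\<lambda>\<omega>. exp (s * X i \<omega>))
      \<le> expectation (\<lambda>\<omega>. 1 + s * X i \<omega> + s\<^sup>2 / 2 * exp (\<bar>s\<bar> * b) * (X i \<omega>)\<^sup>2)"
  proof (rule integral_mono)
    fix \<omega> assume \<omega>: "\<omega> \<in> space M"
    have "exp \<bar>s * X i \<omega>\<bar> \<le> exp (\<bar>s\<bar> * b)"
      using bounded[OF \<omega>, of i] by (auto simp: abs_mult intro!: mult_left_mono)
    then have "(s * X i \<omega>)\<^sup>2 / 2 * exp \<bar>s * X i \<omega>\<bar> \<le> (s * X i \<omega>)\<^sup>2 / 2 * exp (\<bar>s\<bar> * b)"
      by (intro mult_left_mono) auto
    with exp_le_quadratic[of "s * X i \<omega>"]
    show "exp (s * X i \<omega>) \<le> 1 + s * X i \<omega> + s\<^sup>2 / 2 * exp (\<bar>s\<bar> * b) * (X i \<omega>)\<^sup>2"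
      by (simp add: power_mult_distrib mult_ac)
  qed auto
  also have "\<dots> = 1 + s\<^sup>2 * v / 2 * exp (\<bar>s\<bar> * b)"
    by (simp add: expectation_X_sq prob_space)
  also have "\<dots> \<le> exp (s\<^sup>2 * v / 2 * exp (\<bar>s\<bar> * b))" by (rule exp_ge_add_one_self)
  finally show ?thesis .
qed

lemma mgf_S_le: "expectation (\<lambda>\<omega>. exp (s * S n \<omega>)) \<le> exp (n * (s\<^sup>2 * v / 2 * exp (\<bar>s\<bar> * b)))"
proof -
  have "expectation (\<lambda>\<omega>. exp (s * S n \<omega>)) = expectation (\<lambda>\<omega>. \<Prod>i<n. exp (s * X i \<omega>))"
    by (simp add: S_def exp_sum sum_distrib_left)
  also have "\<dots> = (\<Prod>i<n. expectation (\<lambda>\<omega>. exp (s * X i \<omega>)))"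
    by (intro indep_vars_lebesgue_integral indep_vars_compose2[OF indep_vars_subset[OF indep]]) auto
  also have "\<dots> \<le> (\<Prod>i<n. exp (s\<^sup>2 * v / 2 * exp (\<bar>s\<bar> * b)))"
    by (intro prod_mono conjI mgf_X_le) auto
  finally show ?thesis by (simp flip: exp_of_nat_mult)
qed

lemma indep_disjoint_blocks:
  assumes "A \<inter> B = {}"
    and f: "f \<in> borel_measurable (PiM A (\<lambda>_. borel))"
    and g: "g \<in> borel_measurable (PiM B (\<lambda>_. borel))"
  shows "indep_var borel (\<lambda>\<omega>. f (\<lambda>i\<in>A. X i \<omega>)) borel (\<lambda>\<omega>. g (\<lambda>i\<in>B. X i \<omega>))"
  using indep_var_compose[OF indep_var_restrict[OF indep assms(1)] f g] by (simp add: o_def)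

text \<open>
  Doob's inequality for the submartingale \<open>exp (s S\<^sub>k)\<close>, by decomposing according to the first time \<open>k\<close>
  at which the walk reaches \<open>a\<close>: the past up to \<open>k\<close> is independent of the increment \<open>D\<close> after \<open>k\<close>, and
  \<open>E exp (s D) \<ge> 1 + s E D = 1\<close>.
\<close>

lemma maximal_inequality:
  assumes "s \<ge> 0"
  shows "prob {\<omega> \<in> space M. \<exists>k\<le>n. a \<le> S k \<omega>} \<le> exp (- s * a) * expectation (\<lambda>\<omega>. exp (s * S n \<omega>))"
proof -
  define A where "A k = {\<omega> \<in> space M. a \<le> S k \<omega> \<and> (\<forall>j<k. S j \<omega> < a)}" for k
  have A_meas [measurable]: "A k \<in> sets M" for k unfolding A_def by measurable
  have disj: "disjoint_family_on A {..n}"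
    unfolding disjoint_family_on_def A_def by (auto simp: not_less[symmetric]) (metis linorder_neqE_nat not_less)
  have union: "{\<omega> \<in> space M. \<exists>k\<le>n. a \<le> S k \<omega>} = (\<Union>k\<le>n. A k)"
  proof (intro equalityI subsetI)
    fix \<omega> assume "\<omega> \<in> {\<omega> \<in> space M. \<exists>k\<le>n. a \<le> S k \<omega>}"
    then obtain k where k: "\<omega> \<in> space M" "k \<le> n" "a \<le> S k \<omega>" by auto
    define l where "l = (LEAST k. a \<le> S k \<omega>)"
    have "a \<le> S l \<omega>" "l \<le> k" "\<forall>j<l. S j \<omega> < a"
      unfolding l_def using k(3) by (auto intro: LeastI Least_le dest: not_less_Least simp: not_le)
    then have "\<omega> \<in> A l" "l \<le> n" using k by (auto simp: A_def)
    then show "\<omega> \<in> (\<Union>k\<le>n. A k)" by blast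
  qed (auto simp: A_def)
  have int1: "integrable M (\<lambda>\<omega>. indicator (A k) \<omega> * exp (s * S l \<omega>))" for k l
    by (rule integrable_real_mult_indicator[OF A_meas integrable_exp_sum[of "{..<l}" s, folded S_def], unfolded mult.commute[of _ "indicator _ _"]]) simp
  have step: "exp (s * a) * prob (A k) \<le> expectation (\<lambda>\<omega>. indicator (A k) \<omega> * exp (s * S n \<omega>))"
    if "k \<le> n" for k
  proof -
    define D where "D \<omega> = (\<Sum>i\<in>{k..<n}. X i \<omega>)" for \<omega>
    have split: "S n \<omega> = S k \<omega> + D \<omega>" for \<omega>
      unfolding S_def D_def using that by (metis atLeast0LessThan sum.atLeastLessThan_concat zero_le)
    \<comment> \<open>Past and future written as functions of disjoint blocks of coordinates.\<close>
    define f :: "(nat \<Rightarrow> real) \<Rightarrow> real" where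
      "f = (\<lambda>v. (if a \<le> (\<Sum>i<k. v i) \<and> (\<forall>j\<in>{..<k}. (\<Sum>i<j. v i) < a) then exp (s * (\<Sum>i<k. v i)) else 0))"
    define g :: "(nat \<Rightarrow> real) \<Rightarrow> real" where "g = (\<lambda>v. exp (s * (\<Sum>i\<in>{k..<n}. v i)))"
    have f_meas: "f \<in> borel_measurable (PiM {..<k} (\<lambda>_. borel))"
    proof -
      have [measurable]: "(\<lambda>v. \<Sum>i<j. v i :: real) \<in> borel_measurable (PiM {..<k} (\<lambda>_. borel))" if "j \<le> k" for j
        by (intro borel_measurable_sum measurable_component_singleton) (use that in auto)
      have [measurable]: "Measurable.pred (PiM {..<k} (\<lambda>_. borel)) (\<lambda>v. \<forall>j\<in>{..<k}. (\<Sum>i<j. v i :: real) < a)"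
        by (intro pred_intros_finite) auto
      show ?thesis unfolding f_def by measurable
    qed
    have g_meas: "g \<in> borel_measurable (PiM {k..<n} (\<lambda>_. borel))"
      unfolding g_def by measurable
    have f_eq: "f (\<lambda>i\<in>{..<k}. X i \<omega>) = indicator (A k) \<omega> * exp (s * S k \<omega>)" if "\<omega> \<in> space M" for \<omega>
    proof -
      have "(\<Sum>i<j. (\<lambda>i\<in>{..<k}. X i \<omega>) i) = S j \<omega>" if "j \<le> k" for j
        unfolding S_def by (intro sum.cong) (use that in auto)
      then show ?thesis using that by (auto simp: f_def A_def indicator_def)
    qed
    have g_eq: "g (\<lambda>i\<in>{k..<n}. X i \<omega>) = exp (s * D \<omega>)" for \<omega>
      by (simp add: g_def D_def)
    have int_D: "integrable M (\<lambda>\<omega>. exp (s * D \<omega>))" unfolding D_def by simp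
    have int_f: "integrable M (\<lambda>\<omega>. f (\<lambda>i\<in>{..<k}. X i \<omega>))"
      using int1[of k k] by (subst Bochner_Integration.integrable_cong[OF refl f_eq]) auto
    have "exp (s * a) * prob (A k) = expectation (\<lambda>\<omega>. indicator (A k) \<omega> * exp (s * a))"
      by simp
    also have "\<dots> \<le> expectation (\<lambda>\<omega>. indicator (A k) \<omega> * exp (s * S k \<omega>))"
    proof (rule integral_mono[OF _ int1])
      show "integrable M (\<lambda>\<omega>. indicat_real (A k) \<omega> * exp (s * a))" by (intro integrable_mult_left) (simp add: less_top[symmetric])
    qed (auto simp: indicator_def A_def intro!: mult_left_mono assms)
    also have "\<dots> \<le> expectation (\<lambda>\<omega>. indicator (A k) \<omega> * exp (s * S k \<omega>)) * expectation (\<lambda>\<omega>. exp (s * D \<omega>))"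
    proof -
      have "1 = expectation (\<lambda>\<omega>. 1 + s * D \<omega>)" by (simp add: D_def prob_space)
      also have "\<dots> \<le> expectation (\<lambda>\<omega>. exp (s * D \<omega>))"
        by (rule integral_mono[OF _ int_D]) (auto simp: D_def)
      finally have "1 \<le> expectation (\<lambda>\<omega>. exp (s * D \<omega>))" .
      from mult_left_mono[OF this, of "expectation (\<lambda>\<omega>. indicator (A k) \<omega> * exp (s * S k \<omega>))"]
      show ?thesis by simp
    qed
    also have "\<dots> = expectation (\<lambda>\<omega>. f (\<lambda>i\<in>{..<k}. X i \<omega>)) * expectation (\<lambda>\<omega>. g (\<lambda>i\<in>{k..<n}. X i \<omega>))"
      unfolding g_eq by (simp add: f_eq cong: Bochner_Integration.integral_cong)
    also have "\<dots> = expectation (\<lambda>\<omega>. f (\<lambda>i\<in>{..<k}. X i \<omega>) * g (\<lambda>i\<in>{k..<n}. X i \<omega>))"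
      by (intro indep_var_lebesgue_integral[symmetric] indep_disjoint_blocks f_meas g_meas int_f)
         (auto simp: g_eq int_D)
    also have "\<dots> = expectation (\<lambda>\<omega>. indicator (A k) \<omega> * exp (s * S n \<omega>))"
      unfolding g_eq
      by (intro Bochner_Integration.integral_cong refl) (simp add: f_eq split exp_add ring_distribs)
    finally show ?thesis .
  qed
  have "exp (s * a) * prob {\<omega> \<in> space M. \<exists>k\<le>n. a \<le> S k \<omega>} = (\<Sum>k\<le>n. exp (s * a) * prob (A k))"
    unfolding union by (subst finite_measure_finite_Union[OF _ _ disj]) (auto simp: sum_distrib_left)
  also have "\<dots> \<le> (\<Sum>k\<le>n. expectation (\<lambda>\<omega>. indicator (A k) \<omega> * exp (s * S n \<omega>)))"
    by (intro sum_mono step) auto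
  also have "\<dots> = expectation (\<lambda>\<omega>. \<Sum>k\<le>n. indicator (A k) \<omega> * exp (s * S n \<omega>))"
    by (intro Bochner_Integration.integral_sum[symmetric] int1)
  also have "\<dots> \<le> expectation (\<lambda>\<omega>. exp (s * S n \<omega>))"
  proof (rule integral_mono)
    fix \<omega>
    have "(\<Sum>k\<le>n. indicator (A k) \<omega> * exp (s * S n \<omega>)) = indicator (\<Union>k\<le>n. A k) \<omega> * exp (s * S n \<omega>)"
      unfolding sum_distrib_right[symmetric] by (subst indicator_UN_disjoint[OF _ disj]) auto
    also have "\<dots> \<le> exp (s * S n \<omega>)" by (simp add: indicator_def)
    finally show "(\<Sum>k\<le>n. indicator (A k) \<omega> * exp (s * S n \<omega>)) \<le> exp (s * S n \<omega>)" .
  next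
    show "integrable M (\<lambda>\<omega>. \<Sum>k\<le>n. indicator (A k) \<omega> * exp (s * S n \<omega>))"
      by (intro Bochner_Integration.integrable_sum int1)
    show "integrable M (\<lambda>\<omega>. exp (s * S n \<omega>))" by (simp add: S_def)
  qed
  finally have "exp (s * a) * prob {\<omega> \<in> space M. \<exists>k\<le>n. a \<le> S k \<omega>} \<le> expectation (\<lambda>\<omega>. exp (s * S n \<omega>))" .
  then have "exp (- s * a) * (exp (s * a) * prob {\<omega> \<in> space M. \<exists>k\<le>n. a \<le> S k \<omega>})
      \<le> exp (- s * a) * expectation (\<lambda>\<omega>. exp (s * S n \<omega>))"
    by (intro mult_left_mono) auto
  then show ?thesis by (simp add: mult.assoc[symmetric] flip: exp_add)
qed

lemma maximal_tail:
  fixes n :: nat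
  assumes "s \<ge> 0"
  shows "prob {\<omega> \<in> space M. \<exists>k\<le>n. a \<le> S k \<omega>} \<le> exp (n * (s\<^sup>2 * v / 2 * exp (s * b)) - s * a)"
proof -
  have "prob {\<omega> \<in> space M. \<exists>k\<le>n. a \<le> S k \<omega>} \<le> exp (- s * a) * exp (n * (s\<^sup>2 * v / 2 * exp (\<bar>s\<bar> * b)))"
    by (rule order.trans[OF maximal_inequality[OF assms] mult_left_mono[OF mgf_S_le]]) auto
  then show ?thesis using assms by (simp flip: exp_add)
qed

end

section \<open>The law of the iterated logarithm: upper half\<close>

context bounded_centred_iid begin

text \<open>
  The times are grouped into the intervals \<open>[\<rho>\<^sup>k, \<rho>\<^sup>k\<^sup>+\<^sup>1)\<close> with \<open>\<rho> = 1 + \<epsilon>\<close>.  On the \<open>k\<close>-th interval the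
  target exceeds \<open>a k\<close>, its value at the left end, and the maximal inequality with the
  optimal \<open>s = a / (\<rho>\<^sup>k\<^sup>+\<^sup>1 v)\<close> bounds the probability of reaching \<open>a k\<close> by \<open>k\<close> to a power below \<open>-1\<close>:
  a factor \<open>\<rho>\<close> is lost on comparing the two ends, but \<open>\<rho>\<^sup>2\<close> was gained by the factor \<open>1 + \<epsilon>\<close>.
\<close>

lemma lil_upper_eps:
  assumes "v > 0" "\<epsilon> > 0"
  shows "AE \<omega> in M. eventually (\<lambda>n. S n \<omega> < (1 + \<epsilon>) * sqrt (2 * v) * sqrt (n * ln (ln n))) sequentially"
proof -
  define \<rho> where "\<rho> = 1 + \<epsilon>"
  have \<rho>: "\<rho> > 1" "\<rho> > 0" "ln \<rho> > 0" using assms by (auto simp: \<rho>_def)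
  define L where "L k = ln (real k * ln \<rho>)" for k
  define a where "a k = \<rho> * sqrt (2 * v) * sqrt (\<rho> ^ k * L k)" for k
  define s where "s k = a k / (\<rho> ^ Suc k * v)" for k
  define N where "N k = nat \<lfloor>\<rho> ^ Suc k\<rfloor>" for k
  define A where "A k = {\<omega> \<in> space M. \<exists>n\<le>N k. a k \<le> S n \<omega>}" for k
  have A_meas [measurable]: "A k \<in> sets M" for k unfolding A_def by measurable
  have L_pos: "eventually (\<lambda>k. L k > 0) sequentially"
    unfolding L_def using \<rho>(3) by real_asymp
  have s_lim: "s \<longlonglongrightarrow> 0"
  proof -
    have "(\<lambda>k. norm (L k / \<rho> ^ k)) \<longlonglongrightarrow> 0"
    proof (rule tendsto_sandwich[OF _ _ tendsto_const])
      show "(\<lambda>k. ln \<rho> * (of_nat k * (1 / \<rho>) ^ k)) \<longlonglongrightarrow> 0"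
        using tendsto_mult_left[OF powser_times_n_limit_0[of "1 / \<rho>"], of "ln \<rho>"] \<rho> by simp
      show "eventually (\<lambda>k. norm (L k / \<rho> ^ k) \<le> ln \<rho> * (of_nat k * (1 / \<rho>) ^ k)) sequentially"
        using L_pos eventually_gt_at_top[of 0]
      proof eventually_elim
        case (elim k)
        have "L k \<le> real k * ln \<rho>" unfolding L_def by (rule order.trans[OF ln_le_minus_one]) (use elim \<rho> in auto)
        then have "L k * (1 / \<rho>) ^ k \<le> real k * ln \<rho> * (1 / \<rho>) ^ k"
          by (rule mult_right_mono) (use \<rho> in auto)
        then show ?case using elim \<rho> by (simp add: power_divide field_simps)
      qed
    qed auto
    then have "(\<lambda>k. L k / \<rho> ^ k) \<longlonglongrightarrow> 0" by (rule tendsto_norm_zero_cancel)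
    from tendsto_mult_left[OF tendsto_real_sqrt[OF this], of "sqrt (2 * v) / v"]
    have "(\<lambda>k. sqrt (2 * v) / v * sqrt (L k / \<rho> ^ k)) \<longlonglongrightarrow> 0" by simp
    also have "(\<lambda>k. sqrt (2 * v) / v * sqrt (L k / \<rho> ^ k)) = s"
    proof
      fix k
      have "sqrt (\<rho> ^ k * L k) = \<rho> ^ k * sqrt (L k / \<rho> ^ k)"
      proof -
        have "\<rho> ^ k * L k = (\<rho> ^ k)\<^sup>2 * (L k / \<rho> ^ k)"
          using \<rho> by (simp add: power2_eq_square)
        then show ?thesis using \<rho> by (simp only: real_sqrt_mult) simp
      qed
      then show "sqrt (2 * v) / v * sqrt (L k / \<rho> ^ k) = s k"
        using \<rho> assms by (simp add: s_def a_def field_simps)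
    qed
    finally show ?thesis .
  qed
  have bound: "eventually (\<lambda>k. prob (A k) \<le> (real k * ln \<rho>) powr (- (1 + \<epsilon> / 2))) sequentially"
  proof -
    have "(\<lambda>k. \<rho> * (2 - exp (s k * b))) \<longlonglongrightarrow> \<rho> * (2 - exp (0 * b))"
      by (intro tendsto_intros s_lim)
    then have "eventually (\<lambda>k. \<rho> * (2 - exp (s k * b)) > 1 + \<epsilon> / 2) sequentially"
      by (rule order_tendstoD(1)) (use assms in \<open>auto simp: \<rho>_def\<close>)
    then show ?thesis using L_pos eventually_gt_at_top[of 0]
    proof eventually_elim
      case (elim k)
      have "a k \<ge> 0" using elim \<rho> assms by (auto simp: a_def intro!: mult_nonneg_nonneg)
      then have s0: "s k \<ge> 0" using \<rho> assms by (simp add: s_def)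
      have asq: "(a k)\<^sup>2 = 2 * \<rho>\<^sup>2 * v * \<rho> ^ k * L k"
        using elim \<rho> assms by (simp add: a_def power_mult_distrib)
      then have sa: "s k * a k = 2 * \<rho> * L k"
        using \<rho> assms by (simp add: s_def power2_eq_square field_simps)
      have s2: "\<rho> ^ Suc k * ((s k)\<^sup>2 * v) = s k * a k"
        using \<rho> assms by (simp add: s_def power2_eq_square)
      have "N k \<le> \<rho> ^ Suc k" using \<rho> by (simp add: N_def del: power_Suc)
      then have "N k * ((s k)\<^sup>2 * v / 2 * exp (s k * b)) \<le> \<rho> ^ Suc k * ((s k)\<^sup>2 * v / 2 * exp (s k * b))"
        by (rule mult_right_mono) (use assms in auto)
      also have "\<dots> = (\<rho> ^ Suc k * ((s k)\<^sup>2 * v)) * exp (s k * b) / 2" by simp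
      also have "\<dots> = \<rho> * L k * exp (s k * b)" unfolding s2 sa by simp
      finally have "N k * ((s k)\<^sup>2 * v / 2 * exp (s k * b)) - s k * a k \<le> - (\<rho> * (2 - exp (s k * b))) * L k"
        unfolding sa by (simp add: algebra_simps)
      also have "\<dots> \<le> - (1 + \<epsilon> / 2) * L k"
        by (rule mult_right_mono) (use elim in auto)
      finally have "exp (N k * ((s k)\<^sup>2 * v / 2 * exp (s k * b)) - s k * a k) \<le> exp (- (1 + \<epsilon> / 2) * L k)"
        by simp
      also have "\<dots> = (real k * ln \<rho>) powr (- (1 + \<epsilon> / 2))"
        using elim \<rho> by (simp add: powr_def L_def)
      finally show ?case
        using maximal_tail[OF s0, of "N k" "a k"] unfolding A_def by linarith
    qed
  qed
  have "summable (\<lambda>k. prob (A k))"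
  proof (rule summable_comparison_test_ev)
    show "eventually (\<lambda>k. norm (prob (A k)) \<le> (real k * ln \<rho>) powr (- (1 + \<epsilon> / 2))) sequentially"
      using bound by simp
    have "summable (\<lambda>k. real k powr (- (1 + \<epsilon> / 2)) * ln \<rho> powr (- (1 + \<epsilon> / 2)))"
      by (intro summable_mult2) (use assms in \<open>simp add: summable_real_powr_iff\<close>)
    then show "summable (\<lambda>k. (real k * ln \<rho>) powr (- (1 + \<epsilon> / 2)))"
      using \<rho> by (simp add: powr_mult)
  qed
  then have "AE \<omega> in M. eventually (\<lambda>k. \<omega> \<in> space M - A k) sequentially"
    by (intro borel_cantelli_AE1) (auto simp: less_top[symmetric])
  then show ?thesis
  proof eventually_elim
    case (elim \<omega>)
    have "eventually (\<lambda>k. \<omega> \<in> space M - A k \<and> L k > 0) sequentially"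
      using elim L_pos by eventually_elim auto
    then obtain K where K: "\<And>k. k \<ge> K \<Longrightarrow> \<omega> \<in> space M - A k \<and> L k > 0"
      by (auto simp: eventually_sequentially)
    have "eventually (\<lambda>n. real n \<ge> \<rho> ^ Suc K) sequentially" by real_asymp
    then show ?case using eventually_gt_at_top[of 0]
    proof eventually_elim
      case n: (elim n)
      define k where "k = nat \<lfloor>log \<rho> n\<rfloor>"
      have "real (Suc K) = log \<rho> (\<rho> ^ Suc K)" using \<rho> by (simp del: power_Suc add: log_nat_power)
      also have "\<dots> \<le> log \<rho> n" using n \<rho> by (subst log_le_cancel_iff) (auto simp del: power_Suc)
      finally have log_ge: "real (Suc K) \<le> log \<rho> n" .
      then have kK: "k \<ge> Suc K" unfolding k_def by linarith
      have k1: "real k \<le> log \<rho> n" and k2: "log \<rho> n < real (Suc k)"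
        unfolding k_def using log_ge by linarith+
      have low: "\<rho> ^ k \<le> n"
        using k1 \<rho> n by (simp add: le_log_iff powr_realpow)
      have "n < \<rho> powr (Suc k)"
        using k2 \<rho> n by (subst (asm) log_less_iff) auto
      then have high: "n < \<rho> ^ Suc k" by (subst (asm) powr_realpow) (use \<rho> in auto)
      have "int n \<le> \<lfloor>\<rho> ^ Suc k\<rfloor>" using high by (simp add: le_floor_iff del: power_Suc)
      then have "n \<le> N k" unfolding N_def by (simp add: nat_le_iff le_nat_iff del: power_Suc)
      moreover from K[of k] kK have "\<omega> \<in> space M - A k" "L k > 0" by auto
      ultimately have "S n \<omega> < a k" by (auto simp: A_def not_le) (meson leD)
      also have "a k \<le> \<rho> * sqrt (2 * v) * sqrt (n * ln (ln n))"
      proof -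
        have "real k * ln \<rho> \<le> ln n" using k1 \<rho> n by (simp add: log_def field_simps)
        then have "L k \<le> ln (ln n)" unfolding L_def using \<rho> kK by (subst ln_le_cancel_iff) (auto intro: less_le_trans[rotated])
        then have "\<rho> ^ k * L k \<le> n * ln (ln n)"
          by (intro mult_mono low) (use \<rho> \<open>L k > 0\<close> in auto)
        then show ?thesis unfolding a_def using \<rho> assms by (intro mult_left_mono) auto
      qed
      finally show ?case by (simp add: \<rho>_def)
    qed
  qed
qed

end

section \<open>The law of the iterated logarithm: lower half\<close>

text \<open>
  Crude, but sharp on the logarithmic scale as \<open>x \<rightarrow> \<infinity>\<close>, which is all the lower half of the law of the
  iterated logarithm requires.
\<close>

lemma std_normal_upper_tail:
  assumes "0 \<le> x"
  shows "1 - cdf std_normal_distribution x \<ge> std_normal_density (x + 1)"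
proof -
  interpret N: real_distribution std_normal_distribution by (rule real_dist_normal_dist)
  have "1 - cdf std_normal_distribution x = measure std_normal_distribution (UNIV - {..x})"
    using N.prob_compl[of "{..x}"] by (simp add: cdf_def)
  also have "\<dots> \<ge> measure std_normal_distribution {x<..x + 1}"
    by (intro N.finite_measure_mono) auto
  also have "measure std_normal_distribution {x<..x + 1} = (\<integral>y. std_normal_density y * indicator {x<..x + 1} y \<partial>lborel)"
    using integral_density[of "indicator {x<..x + 1} :: real \<Rightarrow> real" lborel std_normal_density] by simp
  also have "\<dots> \<ge> (\<integral>y. std_normal_density (x + 1) * indicator {x<..x + 1} y \<partial>lborel)"
  proof (rule integral_mono)
    fix y :: real
    show "std_normal_density (x + 1) * indicator {x<..x + 1} y \<le> std_normal_density y * indicator {x<..x + 1} y"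
    proof (cases "y \<in> {x<..x + 1}")
      case True
      then have "y\<^sup>2 \<le> (x + 1)\<^sup>2" using assms by (intro power_mono) auto
      then have "std_normal_density (x + 1) \<le> std_normal_density y"
        unfolding std_normal_density_def by (intro mult_left_mono) auto
      then show ?thesis using True by simp
    qed simp
  qed (auto intro!: integrable_real_mult_indicator)
  ultimately show ?thesis by simp
qed

text \<open>
  The probability that all events with index \<open>n, \<dots>, n + j - 1\<close> fail is \<open>\<Prod>(1 - P k) \<le> exp (- \<Sum>P k)\<close>,
  which tends to 0 as \<open>j\<close> grows.
\<close>

lemma (in prob_space) second_borel_cantelli:
  fixes Y :: "nat \<Rightarrow> 'a \<Rightarrow> real"
  assumes indep: "indep_vars (\<lambda>_. borel) Y UNIV"
    and div: "\<not> summable (\<lambda>k. \<P>(\<omega> in M. t k \<le> Y k \<omega>))"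
  shows "AE \<omega> in M. frequently (\<lambda>k. t k \<le> Y k \<omega>) sequentially"
proof -
  have [measurable]: "Y k \<in> borel_measurable M" for k using indep by (auto simp: indep_vars_def)
  define P where "P k = \<P>(\<omega> in M. t k \<le> Y k \<omega>)" for k
  have "AE \<omega> in M. \<exists>k\<ge>n. t k \<le> Y k \<omega>" for n
  proof -
    define C where "C = {\<omega> \<in> space M. \<forall>k\<ge>n. Y k \<omega> < t k}"
    have [measurable]: "C \<in> sets M" unfolding C_def by measurable
    have le: "prob C \<le> exp (- (\<Sum>k<j. P (k + n)))" for j
    proof (cases "j = 0")
      case False
      have "prob C \<le> prob (\<Inter>k\<in>{n..<n + j}. Y k -` {..<t k} \<inter> space M)"
        using False by (intro finite_measure_mono) (auto simp: C_def)
      also have "\<dots> = (\<Prod>k\<in>{n..<n + j}. prob (Y k -` {..<t k} \<inter> space M))"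
        by (rule indep_varsD[OF indep]) (use False in auto)
      also have "\<dots> = (\<Prod>k\<in>{n..<n + j}. 1 - P k)"
      proof (rule prod.cong[OF refl])
        fix k
        have "prob (Y k -` {..<t k} \<inter> space M) = prob (space M - {\<omega> \<in> space M. t k \<le> Y k \<omega>})"
          by (rule arg_cong[where f = prob]) auto
        then show "prob (Y k -` {..<t k} \<inter> space M) = 1 - P k"
          unfolding P_def by (subst (asm) prob_compl) auto
      qed
      also have "\<dots> \<le> (\<Prod>k\<in>{n..<n + j}. exp (- P k))"
      proof (intro prod_mono conjI)
        fix k show "0 \<le> 1 - P k" by (simp add: P_def)
        show "1 - P k \<le> exp (- P k)" using exp_ge_add_one_self[of "- P k"] by simp
      qed
      also have "\<dots> = exp (- (\<Sum>k\<in>{n..<n + j}. P k))"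
        by (simp add: exp_sum sum_negf flip: exp_sum)
      also have "(\<Sum>k\<in>{n..<n + j}. P k) = (\<Sum>k<j. P (k + n))"
        by (rule sum.reindex_bij_witness[of _ "\<lambda>k. k + n" "\<lambda>k. k - n"]) auto
      finally show ?thesis .
    qed simp
    have "\<not> summable (\<lambda>k. P (k + n))" using div summable_iff_shift[of P n] by (simp add: P_def[abs_def])
    then have unb: "\<exists>j. (\<Sum>k<j. P (k + n)) > B" for B
      using summableI_nonneg_bounded[of "\<lambda>k. P (k + n)" B] by (force simp: P_def not_le)
    have "prob C = 0"
    proof (rule ccontr)
      assume "prob C \<noteq> 0"
      then have pos: "prob C > 0" by (simp add: zero_less_measure_iff)
      obtain j where "(\<Sum>k<j. P (k + n)) > - ln (prob C)" using unb by blast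
      then have "exp (- (\<Sum>k<j. P (k + n))) < exp (ln (prob C))" by simp
      with le[of j] pos show False by simp
    qed
    then have "AE \<omega> in M. \<omega> \<notin> C" by (simp add: prob_eq_0)
    with AE_space show ?thesis by eventually_elim (auto simp: C_def not_less)
  qed
  then have "AE \<omega> in M. \<forall>n. \<exists>k\<ge>n. t k \<le> Y k \<omega>" by (simp add: AE_all_countable)
  then show ?thesis by (simp add: frequently_sequentially)
qed

context bounded_centred_iid begin

text \<open>
  Only the marginals and independence enter the characteristic function of the sum; so a block of
  the sequence may be replaced by an initial segment of the same length.
\<close>

lemma distr_sum_eq:
  assumes "finite A" "finite B" "card A = card B"
  shows "distr M borel (\<lambda>\<omega>. \<Sum>i\<in>A. X i \<omega>) = distr M borel (\<lambda>\<omega>. \<Sum>i\<in>B. X i \<omega>)"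
proof (rule Levy_uniqueness)
  have *: "char (distr M borel (\<lambda>\<omega>. \<Sum>i\<in>A. X i \<omega>)) t = char (distr M borel (X 0)) t ^ card A" for t and A :: "nat set"
  proof -
    have "char (distr M borel (X i)) t = char (distr M borel (X 0)) t" for i by (subst ident) (rule refl)
    then have "(\<Prod>i\<in>A. char (distr M borel (X i)) t) = (\<Prod>i\<in>A. char (distr M borel (X 0)) t)"
      by (rule prod.cong[OF refl])
    then show ?thesis by (subst char_distr_sum[OF indep_vars_subset[OF indep]]) simp_all
  qed
  show "char (distr M borel (\<lambda>\<omega>. \<Sum>i\<in>A. X i \<omega>)) = char (distr M borel (\<lambda>\<omega>. \<Sum>i\<in>B. X i \<omega>))"
    by (rule ext) (simp only: * assms)
qed (auto intro!: real_distribution_distr)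

lemma prob_sum_eq:
  assumes "finite A" "finite B" "card A = card B"
  shows "\<P>(\<omega> in M. x \<le> (\<Sum>i\<in>A. X i \<omega>)) = \<P>(\<omega> in M. x \<le> (\<Sum>i\<in>B. X i \<omega>))"
proof -
  have "\<P>(\<omega> in M. x \<le> (\<Sum>i\<in>A. X i \<omega>)) = measure (distr M borel (\<lambda>\<omega>. \<Sum>i\<in>A. X i \<omega>)) {x..}" for A :: "nat set"
    by (subst measure_distr) (auto intro!: arg_cong[where f = prob])
  then show ?thesis using distr_sum_eq[OF assms] by metis
qed

lemma indep_sums:
  assumes "disjoint_family_on J L"
  shows "indep_vars (\<lambda>_. borel) (\<lambda>k \<omega>. \<Sum>i\<in>J k. X i \<omega>) L"
proof -
  have "indep_vars (\<lambda>_. borel) (\<lambda>k \<omega>. (\<lambda>v. \<Sum>i\<in>J k. v i) (\<lambda>i\<in>J k. X i \<omega>)) L"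
    by (rule indep_vars_compose2[OF indep_vars_restrict[OF indep _ assms]]) auto
  then show ?thesis by simp
qed

text \<open>
  If each of \<open>m\<close> consecutive blocks of length \<open>l\<close> contributes at least \<open>x\<close>, the sum is at least
  \<open>m x\<close>.  Applied with a fixed \<open>x / \<surd>l\<close> and a growing \<open>m\<close>, this converts the central limit
  theorem into a lower bound for moderate deviations.
\<close>

lemma prob_concatenated_blocks:
  "\<P>(\<omega> in M. x \<le> S l \<omega>) ^ m \<le> \<P>(\<omega> in M. m * x \<le> (\<Sum>i\<in>{n..<n + m * l}. X i \<omega>))"
proof (induction m arbitrary: n)
  case 0
  show ?case by (simp add: prob_space)
next
  case (Suc m)
  let ?J = "\<lambda>c :: nat. if c = 0 then {n..<n + l} else {n + l..<n + l + m * l}"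
  have split: "(\<Sum>i\<in>{n..<n + Suc m * l}. X i \<omega>) = (\<Sum>i\<in>{n..<n + l}. X i \<omega>) + (\<Sum>i\<in>{n + l..<n + l + m * l}. X i \<omega>)" for \<omega>
    by (subst sum.atLeastLessThan_concat) (auto simp: algebra_simps)
  have "indep_vars (\<lambda>_. borel) (\<lambda>k \<omega>. \<Sum>i\<in>?J k. X i \<omega>) {0, 1}"
    by (intro indep_sums) (auto simp: disjoint_family_on_def)
  from indep_varsD[OF this, of "{0, 1}" "\<lambda>c. if c = 0 then {x..} else {m * x..}"]
  have "prob (((\<lambda>\<omega>. \<Sum>i\<in>{n..<n + l}. X i \<omega>) -` {x..} \<inter> space M) \<inter> ((\<lambda>\<omega>. \<Sum>i\<in>{n + l..<n + l + m * l}. X i \<omega>) -` {m * x..} \<inter> space M))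
    = prob ((\<lambda>\<omega>. \<Sum>i\<in>{n..<n + l}. X i \<omega>) -` {x..} \<inter> space M) * prob ((\<lambda>\<omega>. \<Sum>i\<in>{n + l..<n + l + m * l}. X i \<omega>) -` {m * x..} \<inter> space M)"
    by simp
  moreover have "(\<lambda>\<omega>. \<Sum>i\<in>J. X i \<omega>) -` {z..} \<inter> space M = {\<omega> \<in> space M. z \<le> (\<Sum>i\<in>J. X i \<omega>)}" for J z
    by auto
  ultimately have eq: "prob ({\<omega> \<in> space M. x \<le> (\<Sum>i\<in>{n..<n + l}. X i \<omega>)} \<inter> {\<omega> \<in> space M. m * x \<le> (\<Sum>i\<in>{n + l..<n + l + m * l}. X i \<omega>)})
    = \<P>(\<omega> in M. x \<le> (\<Sum>i\<in>{n..<n + l}. X i \<omega>)) * \<P>(\<omega> in M. m * x \<le> (\<Sum>i\<in>{n + l..<n + l + m * l}. X i \<omega>))"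
    by simp
  have "\<P>(\<omega> in M. x \<le> S l \<omega>) ^ Suc m
     \<le> \<P>(\<omega> in M. x \<le> (\<Sum>i\<in>{n..<n + l}. X i \<omega>)) * \<P>(\<omega> in M. m * x \<le> (\<Sum>i\<in>{n + l..<n + l + m * l}. X i \<omega>))"
    unfolding S_def power_Suc
    by (intro mult_mono Suc.IH[unfolded S_def]) (auto simp: prob_sum_eq[of "{n..<n + l}" "{..<l}"])
  also have "\<dots> \<le> \<P>(\<omega> in M. Suc m * x \<le> (\<Sum>i\<in>{n..<n + Suc m * l}. X i \<omega>))"
    unfolding eq[symmetric] split by (intro finite_measure_mono) (auto simp: algebra_simps)
  finally show ?case .
qed

text \<open>
  Halving the lower bound for the normal tail makes room for the error in the central limit theorem.
\<close>

lemma clt_tail: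
  assumes "v > 0" "y \<ge> 0"
  shows "eventually (\<lambda>n. \<P>(\<omega> in M. y * sqrt v * sqrt n \<le> S n \<omega>) \<ge> std_normal_density (y + 1) / 2) sequentially"
proof -
  interpret N: real_distribution std_normal_distribution by (rule real_dist_normal_dist)
  have var: "variance (X n) = (sqrt v)\<^sup>2" for n
    using assms by (simp add: expectation_X_sq)
  have conv: "weak_conv_m (\<lambda>n. distr M borel (\<lambda>\<omega>. S n \<omega> / sqrt (n * (sqrt v)\<^sup>2))) std_normal_distribution"
    unfolding S_def
    by (rule central_limit_theorem_zero_mean[OF indep _ _ _ var ident]) (use assms in auto)
  have "isCont (cdf std_normal_distribution) y"
    unfolding N.isCont_cdf
    by (simp add: measure_def emeasure_density nn_integral_indicator_singleton')
  then have "(\<lambda>n. cdf (distr M borel (\<lambda>\<omega>. S n \<omega> / sqrt (n * (sqrt v)\<^sup>2))) y) \<longlonglongrightarrow> cdf std_normal_distribution y"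
    using conv by (auto simp: weak_conv_m_def weak_conv_def)
  then have "(\<lambda>n. 1 - cdf (distr M borel (\<lambda>\<omega>. S n \<omega> / sqrt (n * (sqrt v)\<^sup>2))) y) \<longlonglongrightarrow> 1 - cdf std_normal_distribution y"
    by (intro tendsto_intros)
  moreover have "std_normal_density (y + 1) / 2 < 1 - cdf std_normal_distribution y"
    using std_normal_upper_tail[OF assms(2)] normal_density_pos[of 1 0 "y + 1"] by linarith
  ultimately have "eventually (\<lambda>n. 1 - cdf (distr M borel (\<lambda>\<omega>. S n \<omega> / sqrt (n * (sqrt v)\<^sup>2))) y > std_normal_density (y + 1) / 2) sequentially"
    by (rule order_tendstoD)
  then show ?thesis using eventually_gt_at_top[of 0]
  proof eventually_elim
    case (elim n)
    let ?Z = "\<lambda>\<omega>. S n \<omega> / sqrt (n * (sqrt v)\<^sup>2)"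
    have "1 - cdf (distr M borel ?Z) y = prob (space M - {\<omega> \<in> space M. ?Z \<omega> \<le> y})"
      by (subst prob_compl) (auto simp: cdf_def measure_distr vimage_def Int_def conj_commute)
    also have "\<dots> \<le> \<P>(\<omega> in M. y * sqrt v * sqrt n \<le> S n \<omega>)"
      using elim assms by (intro finite_measure_mono) (auto simp: field_simps real_sqrt_mult)
    finally show ?case using elim by linarith
  qed
qed

lemma uminus: "bounded_centred_iid M (\<lambda>i \<omega>. - X i \<omega>) b"
proof unfold_locales
  show "indep_vars (\<lambda>_. borel) (\<lambda>i \<omega>. - X i \<omega>) UNIV"
    by (rule indep_vars_compose2[OF indep]) auto
  show "distr M borel (\<lambda>\<omega>. - X i \<omega>) = distr M borel (\<lambda>\<omega>. - X 0 \<omega>)" for i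
  proof -
    have "distr M borel (\<lambda>\<omega>. - X i \<omega>) = distr (distr M borel (X i)) borel uminus" for i
      by (subst distr_distr) (auto simp: o_def)
    then show ?thesis by (metis ident)
  qed
qed (use bounded in auto)

lemma S_uminus: "bounded_centred_iid.S (\<lambda>i \<omega>. - X i \<omega>) n \<omega> = - S n \<omega>"
  by (simp add: bounded_centred_iid.S_def[OF uminus] S_def sum_negf)

lemma v_uminus: "bounded_centred_iid.v M (\<lambda>i \<omega>. - X i \<omega>) = v"
  by (simp add: bounded_centred_iid.v_def[OF uminus] v_def)

text \<open>
  Consider the times \<open>n k = k\<^sup>3\<^sup>k\<close>, which grow so fast that \<open>S (n k)\<close> is negligible at the scale of
  \<open>N k \<ge> (k + 1) n k\<close>, while still \<open>ln (ln (N k)) \<sim> ln k\<close>.  The stretch from \<open>n k\<close> to \<open>N k\<close> is divided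
  into \<open>m k \<approx> c ln k\<close> sub-blocks of length \<open>l k\<close>, each required to exceed \<open>y\<close> standard deviations.
  Their total then exceeds \<open>y \<surd>(m k)\<close> standard deviations of the stretch, so
  \<open>y\<^sup>2 c = 2 \<mu>\<^sup>2\<close> is the right choice for reaching \<open>\<mu> \<surd>(2 ln k)\<close> of them.  The event has probability at least
  \<open>q ^ m k\<close>, where \<open>- ln q = y\<^sup>2 / 2 + O(y)\<close>; for \<open>\<mu> < 1\<close> and \<open>y\<close> large this is at least a multiple
  of \<open>1 / k\<close>.  The stretches are disjoint, so infinitely many of these events occur; that \<open>S (n k)\<close>
  is not too negative comes from the upper half applied to \<open>- X\<close>.
\<close>

lemma lil_lower_eps:
  assumes "v > 0" "0 < \<eta>" "\<eta> < 1"
  shows "AE \<omega> in M. frequently (\<lambda>n. \<eta> * sqrt (2 * v) * sqrt (n * ln (ln n)) \<le> S n \<omega>) sequentially"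
proof -
  \<comment> \<open>The gap between \<open>\<eta>\<close> and \<open>\<mu>\<close> absorbs \<open>S (n k)\<close> and the other lower order terms.\<close>
  define \<mu> where "\<mu> = (1 + \<eta>) / 2"
  have \<mu>: "\<eta> < \<mu>" "0 < \<mu>" "\<mu> < 1" using assms by (auto simp: \<mu>_def)
  define C where "C = ln (2 * sqrt (2 * pi))"
  \<comment> \<open>Up to a constant factor, \<open>k\<close> to the power of minus this expression will bound the probability of the
  event for \<open>k\<close> from below, so it has to be made smaller than 1.\<close>
  have "((\<lambda>y. 2 * \<mu>\<^sup>2 / y\<^sup>2 * ((y + 1)\<^sup>2 / 2 + C)) \<longlongrightarrow> \<mu>\<^sup>2) at_top"
    using \<mu> by real_asymp
  moreover have "\<mu>\<^sup>2 < 1" using \<mu> by (simp add: power_less_one_iff)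
  ultimately have "eventually (\<lambda>y. 2 * \<mu>\<^sup>2 / y\<^sup>2 * ((y + 1)\<^sup>2 / 2 + C) < 1) at_top"
    by (rule order_tendstoD)
  then obtain y where y: "2 * \<mu>\<^sup>2 / y\<^sup>2 * ((y + 1)\<^sup>2 / 2 + C) < 1" "y > 0"
    using eventually_happens'[OF trivial_limit_at_top_linorder eventually_conj[OF _ eventually_gt_at_top[of 0]]]
    by blast
  define c where "c = 2 * \<mu>\<^sup>2 / y\<^sup>2"
  have c: "c > 0" using \<mu> y by (simp add: c_def)
  define q where "q = std_normal_density (y + 1) / 2"
  have q_pos: "q > 0" unfolding q_def using normal_density_pos[of 1 0 "y + 1"] by simp
  have ln_q: "- ln q = (y + 1)\<^sup>2 / 2 + C"
    by (simp add: q_def std_normal_density_def C_def ln_mult ln_div)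
  have "C \<ge> 0"
    unfolding C_def
    by (intro ln_ge_zero) (use pi_gt3 real_sqrt_ge_one[of "2 * pi"] in linarith)
  then have lq0: "- ln q \<ge> 0" using ln_q by simp
  have cq: "c * (- ln q) < 1" using y(1) unfolding ln_q c_def .
  define m where "m k = nat \<lceil>c * ln (real k)\<rceil>" for k
  define n where "n k = k ^ (3 * k)" for k :: nat
  define l where "l k = k * n k" for k
  define N where "N k = n k + m k * l k" for k
  define J where "J k = {n k..<N k}" for k
  define t where "t k = m k * (y * sqrt v * sqrt (l k))" for k
  define D where "D k \<omega> = (\<Sum>i\<in>J k. X i \<omega>)" for k \<omega>
  have "eventually (\<lambda>k. c * ln (real k) \<le> real k) sequentially" using c by real_asymp
  moreover have "filterlim l at_top sequentially"
  proof (rule filterlim_at_top_mono[OF filterlim_ident])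
    show "eventually (\<lambda>k. k \<le> l k) sequentially"
      using eventually_gt_at_top[of 0] by eventually_elim (simp add: l_def n_def Suc_le_eq)
  qed
  then have "eventually (\<lambda>k. q \<le> \<P>(\<omega> in M. y * sqrt v * sqrt (l k) \<le> S (l k) \<omega>)) sequentially"
    unfolding q_def using eventually_compose_filterlim[OF clt_tail[OF assms(1), of y]] y by simp
  ultimately have "eventually (\<lambda>k. c * ln (real k) \<le> real k \<and> q \<le> \<P>(\<omega> in M. y * sqrt v * sqrt (l k) \<le> S (l k) \<omega>) \<and> k \<ge> 2) sequentially"
    using eventually_ge_at_top[of 2] by eventually_elim auto
  then obtain K where K: "\<And>k. k \<ge> K \<Longrightarrow> c * ln (real k) \<le> real k"
      "\<And>k. k \<ge> K \<Longrightarrow> q \<le> \<P>(\<omega> in M. y * sqrt v * sqrt (l k) \<le> S (l k) \<omega>)"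
      "\<And>k. k \<ge> K \<Longrightarrow> k \<ge> 2"
    by (auto simp: eventually_sequentially)
  have m_le: "m k \<le> k" if "k \<ge> K" for k
    unfolding m_def using K(1)[OF that] by (simp add: nat_le_iff ceiling_le_iff)
  have m_low: "c * ln (real k) \<le> m k" if "k \<ge> K" for k
    unfolding m_def using K(3)[OF that] c by (simp add: of_nat_nat real_nat_ceiling_ge)
  have m_high: "m k \<le> c * ln (real k) + 1" if "k \<ge> K" for k
  proof -
    have "0 \<le> c * ln (real k)" using K(3)[OF that] c by simp
    then have "real (nat \<lceil>c * ln (real k)\<rceil>) = \<lceil>c * ln (real k)\<rceil>" by (simp add: le_ceiling_iff)
    then show ?thesis unfolding m_def using of_int_ceiling_le_add_one[of "c * ln (real k)"] by linarith
  qed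
  have m_pos: "m k \<ge> 1" if "k \<ge> K" for k
  proof -
    have "c * ln (real k) > 0" using c K(3)[OF that] by simp
    with m_low[OF that] have "real (m k) > 0" by linarith
    then show ?thesis by simp
  qed
  \<comment> \<open>The stretch for \<open>k\<close> ends before the one for \<open>k + 1\<close> starts.\<close>
  have N_le: "N k \<le> n (Suc k)" if "k \<ge> K" for k
  proof -
    have "N k = n k * (1 + k * m k)" by (simp add: N_def l_def algebra_simps)
    also have "\<dots> \<le> n k * (1 + k * k)" using m_le[OF that] by (intro mult_left_mono add_left_mono) auto
    also have "\<dots> \<le> Suc k ^ (3 * k) * Suc k ^ 3"
    proof (intro mult_mono)
      show "n k \<le> Suc k ^ (3 * k)" unfolding n_def by (intro power_mono) auto
      show "1 + k * k \<le> Suc k ^ 3" by (simp add: eval_nat_numeral)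
    qed auto
    also have "\<dots> = n (Suc k)" by (simp add: n_def power_add[symmetric] algebra_simps)
    finally show ?thesis .
  qed
  have n_mono: "n i \<le> n j" if "i \<le> j" "1 \<le> i" for i j
  proof -
    have "i ^ (3 * i) \<le> j ^ (3 * i)" by (intro power_mono that) auto
    also have "\<dots> \<le> j ^ (3 * j)" by (intro power_increasing) (use that in auto)
    finally show ?thesis by (simp add: n_def)
  qed
  have J_disj: "J i \<inter> J j = {}" if "K \<le> i" "i < j" for i j
  proof -
    have "N i \<le> n j" using N_le[OF that(1)] n_mono[of "Suc i" j] that by auto
    then show ?thesis by (auto simp: J_def)
  qed
  have "disjoint_family_on (\<lambda>k. J (k + K)) UNIV"
    unfolding disjoint_family_on_def
  proof safe
    fix i j x assume "i \<noteq> j" "x \<in> J (i + K)" "x \<in> J (j + K)"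
    then show "x \<in> {}" using J_disj[of "i + K" "j + K"] J_disj[of "j + K" "i + K"]
      by (cases "i < j") auto
  qed
  then have indep_D: "indep_vars (\<lambda>_. borel) (\<lambda>k. D (k + K)) UNIV"
    unfolding D_def by (rule indep_sums)
  have prob_D: "q / real k \<le> \<P>(\<omega> in M. t k \<le> D k \<omega>)" if "k \<ge> K" for k
  proof -
    have k: "real k > 0" using K(3)[OF that] by simp
    \<comment> \<open>\<open>c * (- ln q) < 1\<close>, so \<open>q ^ m k\<close> is at least \<open>q * exp (- ln k)\<close>.\<close>
    have "real (m k) * (- ln q) \<le> (c * ln (real k) + 1) * (- ln q)"
      by (intro mult_right_mono m_high lq0 that)
    also have "\<dots> = (c * (- ln q)) * ln (real k) - ln q" by (simp add: algebra_simps)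
    also have "\<dots> \<le> 1 * ln (real k) - ln q"
      using cq K(3)[OF that] by (intro diff_right_mono mult_right_mono) auto
    finally have "ln q - ln (real k) \<le> real (m k) * ln q" by simp
    then have "exp (ln q - ln (real k)) \<le> exp (real (m k) * ln q)" by simp
    then have "q / real k \<le> q ^ m k"
      using q_pos k by (simp add: exp_diff exp_of_nat_mult)
    also have "\<dots> \<le> \<P>(\<omega> in M. y * sqrt v * sqrt (l k) \<le> S (l k) \<omega>) ^ m k"
      by (intro power_mono K(2) that) (use q_pos in auto)
    also have "\<dots> \<le> \<P>(\<omega> in M. t k \<le> D k \<omega>)"
      unfolding t_def D_def J_def N_def by (rule prob_concatenated_blocks)
    finally show ?thesis .
  qed
  have "\<not> summable (\<lambda>k. \<P>(\<omega> in M. t (k + K) \<le> D (k + K) \<omega>))"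
  proof
    assume "summable (\<lambda>k. \<P>(\<omega> in M. t (k + K) \<le> D (k + K) \<omega>))"
    then have "summable (\<lambda>k. q / real (k + K))"
    proof (rule summable_comparison_test'[where N = 0])
      fix k
      show "norm (q / real (k + K)) \<le> \<P>(\<omega> in M. t (k + K) \<le> D (k + K) \<omega>)"
        using prob_D[of "k + K"] q_pos by simp
    qed
    then have "summable (\<lambda>k. q / real k)"
      using summable_iff_shift[of "\<lambda>k. q / real k" K] by simp
    then have "summable (\<lambda>k. (1 / q) * (q / real k))" by (rule summable_mult)
    then have "summable (\<lambda>k. real k powr -1)"
      using q_pos by (simp add: powr_minus_divide)
    then show False by (simp only: summable_real_powr_iff)
  qed
  from second_borel_cantelli[OF indep_D this]
  have freq: "AE \<omega> in M. frequently (\<lambda>k. t (k + K) \<le> D (k + K) \<omega>) sequentially" .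
  interpret neg: bounded_centred_iid M "\<lambda>i \<omega>. - X i \<omega>" b by (rule uminus)
  have "neg.v > 0" using assms by (simp add: v_uminus)
  from neg.lil_upper_eps[OF this, of 1]
  have upper: "AE \<omega> in M. eventually (\<lambda>n. - S n \<omega> < 2 * sqrt (2 * v) * sqrt (n * ln (ln n))) sequentially"
    by (simp add: S_uminus v_uminus)
  \<comment> \<open>\<open>\<Lambda> k\<close> is \<open>ln (ln (n (k + 1)))\<close>, an upper bound for \<open>ln (ln (N k))\<close>.\<close>
  define \<Lambda> where "\<Lambda> k = ln (3 * (real k + 1) * ln (real k + 1))" for k
  have "((\<lambda>k. \<mu> * (sqrt (ln (real k) * (k / (k + 1))) / sqrt (\<Lambda> k)) - 2 / sqrt (k + 1)) \<longlongrightarrow> \<mu>) sequentially"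
    unfolding \<Lambda>_def by real_asymp
  then have lim: "eventually (\<lambda>k. \<mu> * (sqrt (ln (real k) * (k / (k + 1))) / sqrt (\<Lambda> k)) - 2 / sqrt (k + 1) > \<eta>) sequentially"
    using \<mu> by (intro order_tendstoD)
  have n_lim: "filterlim n at_top sequentially"
  proof (rule filterlim_at_top_mono[OF filterlim_ident])
    show "eventually (\<lambda>k. k \<le> n k) sequentially"
      using eventually_gt_at_top[of 0]
    proof eventually_elim
      case (elim k)
      then show ?case unfolding n_def using power_increasing[of 1 "3 * k" k] by simp
    qed
  qed
  have n_large: "eventually (\<lambda>k. real (n k) \<ge> 3) sequentially"
    using eventually_compose_filterlim[OF eventually_ge_at_top[of 3] n_lim]
    by eventually_elim simp
  show ?thesis using upper freq
  proof eventually_elim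
    case (elim \<omega>)
    have "eventually (\<lambda>k. - S (n k) \<omega> < 2 * sqrt (2 * v) * sqrt (n k * ln (ln (n k)))) sequentially"
      using eventually_compose_filterlim[OF elim(1) n_lim] by simp
    with lim n_large eventually_ge_at_top[of K]
    have ev: "eventually (\<lambda>k. t k \<le> D k \<omega> \<longrightarrow>
        \<eta> * sqrt (2 * v) * sqrt (N k * ln (ln (N k))) \<le> S (N k) \<omega> \<and> k \<le> N k) sequentially"
    proof eventually_elim
      case k: (elim k)
      have k2: "k \<ge> 2" using K(3) k by simp
      have nN: "n k * (k + 1) \<le> N k"
        using m_pos[of k] k by (auto simp: N_def l_def algebra_simps)
      have n3: "3 \<le> n k" using k by simp
      have N3: "3 \<le> real (N k)" using nN n3 by (metis le_add2 le_trans mult.right_neutral mult_le_mono2 numeral_le_real_of_nat_iff)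
      have ln3: "1 < ln (3 :: real)" using ln3_gt_1 .
      have ln_n: "1 < ln (real (n k))"
        using ln3 n3 by (auto intro: less_le_trans)
      have n_le_N: "n k \<le> N k" by (simp add: N_def)
      have ln_N: "ln (real (n k)) \<le> ln (real (N k))" using n3 n_le_N by simp
      have "real (N k) \<le> real (Suc k) ^ (3 * Suc k)"
        using N_le[of k] k(3) unfolding n_def by (metis of_nat_le_iff of_nat_power)
      then have "ln (real (N k)) \<le> ln (real (Suc k) ^ (3 * Suc k))" using N3 by (subst ln_le_cancel_iff) auto
      also have "\<dots> = 3 * (real k + 1) * ln (real k + 1)" by (subst ln_realpow) (auto simp: algebra_simps)
      finally have ln_N': "ln (real (N k)) \<le> 3 * (real k + 1) * ln (real k + 1)" .
      have lnln: "0 < ln (ln (real (n k)))" "ln (ln (real (n k))) \<le> ln (ln (real (N k)))" "ln (ln (real (N k))) \<le> \<Lambda> k"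
        unfolding \<Lambda>_def using ln_n ln_N ln_N' by (auto intro!: iffD2[OF ln_le_cancel_iff])
      show ?case
      proof (intro impI conjI)
        assume tD: "t k \<le> D k \<omega>"
        have "S (N k) \<omega> = S (n k) \<omega> + D k \<omega>"
          unfolding S_def D_def J_def using n_le_N by (metis atLeast0LessThan sum.atLeastLessThan_concat zero_le)
        then have SN: "t k - 2 * sqrt (2 * v) * sqrt (n k * ln (ln (n k))) \<le> S (N k) \<omega>"
          using tD k by linarith
        define R where "R = real (N k)"
        have R: "R > 0" using N3 by (simp add: R_def)
        have nR: "real (n k) \<le> R / (real k + 1)"
        proof -
          have "real (n k) * (real k + 1) \<le> R" unfolding R_def using nN by (metis of_nat_1 of_nat_add of_nat_le_iff of_nat_mult)
          then show ?thesis by (simp add: field_simps)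
        qed
        have ml: "real (m k) * real (l k) \<ge> R * (k / (k + 1))"
        proof -
          have "real (m k) * real (l k) = R - n k" unfolding R_def N_def by simp
          also have "\<dots> \<ge> R - R / (real k + 1)" using nR by simp
          also have "R - R / (real k + 1) = R * (k / (k + 1))" by (simp add: field_simps)
          finally show ?thesis .
        qed
        have ym: "\<mu> * sqrt 2 * sqrt (ln k) \<le> y * sqrt (m k)"
        proof -
          have "\<mu> * sqrt 2 * sqrt (ln k) = sqrt (y\<^sup>2 * (c * ln k))"
            using \<mu> y by (simp add: c_def real_sqrt_mult)
          also have "\<dots> \<le> sqrt (y\<^sup>2 * m k)" using m_low[OF k(3)] by (intro real_sqrt_le_mono mult_left_mono) auto
          also have "\<dots> = y * sqrt (m k)" using y by (simp add: real_sqrt_mult)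
          finally show ?thesis .
        qed
        have sqrt_ml: "sqrt (R * (k / (k + 1))) \<le> sqrt (m k * l k)"
          using ml by (simp only: of_nat_mult real_sqrt_le_iff)
        have "t k = sqrt v * ((y * sqrt (m k)) * sqrt (m k * l k))"
        proof -
          have "sqrt v * ((y * sqrt (m k)) * sqrt (m k * l k)) = (sqrt (m k) * sqrt (m k)) * (y * sqrt v * sqrt (l k))"
            by (simp only: real_sqrt_mult of_nat_mult mult_ac)
          also have "\<dots> = t k" by (simp add: t_def)
          finally show ?thesis by (rule sym)
        qed
        also have "\<dots> \<ge> sqrt v * ((\<mu> * sqrt 2 * sqrt (ln k)) * sqrt (R * (k / (k + 1))))"
          by (rule mult_left_mono[OF mult_mono[OF ym sqrt_ml]]) (use assms y R in simp_all)
        also have "sqrt v * ((\<mu> * sqrt 2 * sqrt (ln k)) * sqrt (R * (k / (k + 1))))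
            = sqrt (2 * v) * sqrt R * (\<mu> * sqrt (ln k * (k / (k + 1))))"
          by (simp only: real_sqrt_mult mult_ac)
        finally have t_ge: "sqrt (2 * v) * sqrt R * (\<mu> * sqrt (ln k * (k / (k + 1)))) \<le> t k" .
        have "real (n k) * ln (ln (n k)) \<le> R / (real k + 1) * \<Lambda> k"
          by (intro mult_mono nR) (use lnln R in auto)
        then have "sqrt (real (n k) * ln (ln (n k))) \<le> sqrt (R / (real k + 1) * \<Lambda> k)"
          by (rule real_sqrt_le_mono)
        also have "\<dots> = sqrt R * (sqrt (\<Lambda> k) / sqrt (k + 1))"
          by (simp add: real_sqrt_mult real_sqrt_divide add_ac)
        finally have "sqrt (real (n k) * ln (ln (n k))) \<le> sqrt R * (sqrt (\<Lambda> k) / sqrt (k + 1))" .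
        then have "2 * sqrt (2 * v) * sqrt (n k * ln (ln (n k))) \<le> 2 * sqrt (2 * v) * (sqrt R * (sqrt (\<Lambda> k) / sqrt (k + 1)))"
          using assms by (intro mult_left_mono) auto
        with SN t_ge have "sqrt (2 * v) * sqrt R * (\<mu> * sqrt (ln k * (k / (k + 1))))
            - 2 * sqrt (2 * v) * (sqrt R * (sqrt (\<Lambda> k) / sqrt (k + 1))) \<le> S (N k) \<omega>" by linarith
        moreover have "sqrt (2 * v) * sqrt R * (\<mu> * sqrt (ln k * (k / (k + 1))))
            - 2 * sqrt (2 * v) * (sqrt R * (sqrt (\<Lambda> k) / sqrt (k + 1)))
          = sqrt (2 * v) * sqrt R * sqrt (\<Lambda> k) * (\<mu> * (sqrt (ln (real k) * (k / (k + 1))) / sqrt (\<Lambda> k)) - 2 / sqrt (k + 1))"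
          using lnln by (simp add: algebra_simps)
        moreover have "sqrt (2 * v) * sqrt R * sqrt (\<Lambda> k) * \<eta>
          \<le> sqrt (2 * v) * sqrt R * sqrt (\<Lambda> k) * (\<mu> * (sqrt (ln (real k) * (k / (k + 1))) / sqrt (\<Lambda> k)) - 2 / sqrt (k + 1))"
          by (intro mult_left_mono) (use k(1) assms R lnln in auto)
        moreover have "\<eta> * sqrt (2 * v) * sqrt (N k * ln (ln (N k))) \<le> sqrt (2 * v) * sqrt R * sqrt (\<Lambda> k) * \<eta>"
        proof -
          have "sqrt (N k * ln (ln (N k))) \<le> sqrt R * sqrt (\<Lambda> k)"
            unfolding R_def real_sqrt_mult using lnln by (intro mult_left_mono) auto
          then have "\<eta> * sqrt (2 * v) * sqrt (N k * ln (ln (N k))) \<le> \<eta> * sqrt (2 * v) * (sqrt R * sqrt (\<Lambda> k))"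
            using assms by (intro mult_left_mono) auto
          then show ?thesis by (simp add: mult_ac)
        qed
        ultimately show "\<eta> * sqrt (2 * v) * sqrt (N k * ln (ln (N k))) \<le> S (N k) \<omega>" by linarith
        have "k * 1 \<le> n k * (k + 1)" using n3 by (metis One_nat_def add.commute le_add2 mult.commute mult_le_mono numeral_le_real_of_nat_iff one_le_numeral order_trans plus_1_eq_Suc)
        then show "k \<le> N k" using nN by simp
      qed
    qed
    show ?case
      unfolding frequently_sequentially
    proof
      fix j
      have "eventually (\<lambda>k. j \<le> k \<and> (t k \<le> D k \<omega> \<longrightarrow>
        \<eta> * sqrt (2 * v) * sqrt (N k * ln (ln (N k))) \<le> S (N k) \<omega> \<and> k \<le> N k)) sequentially"
        using ev eventually_ge_at_top[of j] by eventually_elim auto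
      then have ev': "eventually (\<lambda>k. j \<le> k + K \<and> (t (k + K) \<le> D (k + K) \<omega> \<longrightarrow>
        \<eta> * sqrt (2 * v) * sqrt (N (k + K) * ln (ln (N (k + K)))) \<le> S (N (k + K)) \<omega> \<and> k + K \<le> N (k + K))) sequentially"
        by (rule eventually_all_ge_at_top[THEN eventually_mono, THEN eventually_compose_filterlim[OF _ filterlim_add_const_nat_at_top]]) auto
      from frequently_eventually_frequently[OF elim(2) ev']
      obtain k where "t (k + K) \<le> D (k + K) \<omega>" "j \<le> k + K"
          "\<eta> * sqrt (2 * v) * sqrt (N (k + K) * ln (ln (N (k + K)))) \<le> S (N (k + K)) \<omega> \<and> k + K \<le> N (k + K)"
        using frequently_ex by blast
      then show "\<exists>n\<ge>j. \<eta> * sqrt (2 * v) * sqrt (n * ln (ln n)) \<le> S n \<omega>"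
        by (intro exI[of _ "N (k + K)"]) auto
    qed
  qed
qed

theorem law_of_the_iterated_logarithm:
  assumes "v > 0"
  shows "AE \<omega> in M. limsup (\<lambda>n. ereal (S n \<omega> / sqrt (n * ln (ln n)))) = ereal (sqrt (2 * v))"
proof -
  define e where "e j = 1 / real (j + 2)" for j :: nat
  have e: "0 < e j" "e j < 1" "0 < 1 - e j" "1 - e j < 1" for j by (auto simp: e_def)
  have "AE \<omega> in M. \<forall>j. eventually (\<lambda>n. S n \<omega> < (1 + e j) * sqrt (2 * v) * sqrt (n * ln (ln n))) sequentially"
    using lil_upper_eps[OF assms e(1)] by (simp add: AE_all_countable)
  moreover have "AE \<omega> in M. \<forall>j. frequently (\<lambda>n. (1 - e j) * sqrt (2 * v) * sqrt (n * ln (ln n)) \<le> S n \<omega>) sequentially"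
    using lil_lower_eps[OF assms e(3,4)] by (simp add: AE_all_countable)
  ultimately show ?thesis
  proof eventually_elim
    case (elim \<omega>)
    let ?L = "limsup (\<lambda>n. ereal (S n \<omega> / sqrt (n * ln (ln n))))"
    have pos: "eventually (\<lambda>n. sqrt (real n * ln (ln (real n))) > 0) sequentially" by real_asymp
    have up: "?L \<le> ereal ((1 + e j) * sqrt (2 * v))" for j
    proof (rule Limsup_bounded)
      show "eventually (\<lambda>n. ereal (S n \<omega> / sqrt (n * ln (ln n))) \<le> ereal ((1 + e j) * sqrt (2 * v))) sequentially"
        using spec[OF elim(1), of j] pos by eventually_elim (simp add: field_simps)
    qed
    have low: "ereal ((1 - e j) * sqrt (2 * v)) \<le> ?L" for j
    proof (rule ccontr)
      assume "\<not> ereal ((1 - e j) * sqrt (2 * v)) \<le> ?L"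
      then have "eventually (\<lambda>n. ereal (S n \<omega> / sqrt (n * ln (ln n))) < ereal ((1 - e j) * sqrt (2 * v))) sequentially"
        by (intro Limsup_lessD) (simp add: not_le)
      with pos have "eventually (\<lambda>n. \<not> (1 - e j) * sqrt (2 * v) * sqrt (n * ln (ln n)) \<le> S n \<omega>) sequentially"
        by eventually_elim (metis less_ereal.simps(1) not_le pos_divide_less_eq)
      with spec[OF elim(2), of j] show False by (simp add: frequently_def)
    qed
    have "e \<longlonglongrightarrow> 0" unfolding e_def by real_asymp
    then have "(\<lambda>j. (1 + e j) * sqrt (2 * v)) \<longlonglongrightarrow> (1 + 0) * sqrt (2 * v)" "(\<lambda>j. (1 - e j) * sqrt (2 * v)) \<longlonglongrightarrow> (1 - 0) * sqrt (2 * v)"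
      by (intro tendsto_intros; assumption)+
    then have lims: "(\<lambda>j. ereal ((1 + e j) * sqrt (2 * v))) \<longlonglongrightarrow> ereal (sqrt (2 * v))" "(\<lambda>j. ereal ((1 - e j) * sqrt (2 * v))) \<longlonglongrightarrow> ereal (sqrt (2 * v))"
      by simp_all
    show ?case
    proof (rule antisym)
      show "?L \<le> ereal (sqrt (2 * v))" by (rule LIMSEQ_le_const[OF lims(1)]) (use up in auto)
      show "ereal (sqrt (2 * v)) \<le> ?L" by (rule LIMSEQ_le_const2[OF lims(2)]) (use low in auto)
    qed
  qed
qed

lemma law_of_the_iterated_logarithm_minus:
  assumes "v > 0"
  shows "AE \<omega> in M. limsup (\<lambda>n. ereal (- (S n \<omega> / sqrt (n * ln (ln n))))) = ereal (sqrt (2 * v))"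
  using bounded_centred_iid.law_of_the_iterated_logarithm[OF uminus] assms
  by (simp add: S_uminus v_uminus)

end

section \<open>Almost sure bounds that are uniform over a grid\<close>

context bounded_centred_iid begin

lemma abs_tail:
  assumes "s \<ge> 0"
  shows "\<P>(\<omega> in M. t \<le> \<bar>S n \<omega>\<bar>) \<le> 2 * exp (n * (s\<^sup>2 * v / 2 * exp (s * b)) - s * t)"
proof -
  let ?B = "exp (n * (s\<^sup>2 * v / 2 * exp (s * b)) - s * t)"
  interpret neg: bounded_centred_iid M "\<lambda>i \<omega>. - X i \<omega>" b by (rule uminus)
  have "\<P>(\<omega> in M. t \<le> \<bar>S n \<omega>\<bar>) \<le> prob ({\<omega> \<in> space M. \<exists>k\<le>n. t \<le> S k \<omega>} \<union> {\<omega> \<in> space M. \<exists>k\<le>n. t \<le> - S k \<omega>})"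
    by (intro finite_measure_mono) (auto simp: abs_if)
  also have "\<dots> \<le> prob {\<omega> \<in> space M. \<exists>k\<le>n. t \<le> S k \<omega>} + prob {\<omega> \<in> space M. \<exists>k\<le>n. t \<le> - S k \<omega>}"
    by (rule measure_Un_le) auto
  also have "\<dots> \<le> ?B + ?B"
    using maximal_tail[OF assms, where n = n and a = t] neg.maximal_tail[OF assms, where n = n and a = t]
    by (intro add_mono) (auto simp: S_uminus v_uminus)
  finally show ?thesis by simp
qed

end

text \<open>
  The exponential inequality with \<open>s = n\<^sup>-\<^sup>(\<^sup>1\<^sup>-\<^sup>\<delta>\<^sup>)\<^sup>/\<^sup>2\<close>, for which \<open>n v s\<^sup>2\<close> stays bounded, shows that exceeding the standard
  deviation by a factor \<open>n\<^sup>1\<^sup>/\<^sup>1\<^sup>0\<close> has probability of order \<open>exp (- n\<^sup>1\<^sup>/\<^sup>1\<^sup>0)\<close>.  This is summable even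
  after a union bound over \<open>n + 1\<close> grid points.
\<close>

lemma (in prob_space) uniform_deviation:
  assumes iid: "\<And>n j. bounded_centred_iid M (X n j) 2"
    and var: "\<And>n j. n > 0 \<Longrightarrow> j \<le> n \<Longrightarrow> bounded_centred_iid.v M (X n j) \<le> real n powr (- \<delta>)"
    and \<delta>: "0 \<le> \<delta>" "\<delta> < 1"
  shows "AE \<omega> in M. eventually (\<lambda>n. \<forall>j\<le>n. \<bar>\<Sum>i<n. X n j i \<omega>\<bar> \<le> real n powr ((1 - \<delta>) / 2 + 1 / 10)) sequentially"
proof -
  define t where "t n = real n powr ((1 - \<delta>) / 2 + 1 / 10)" for n :: nat
  define s where "s n = real n powr (- (1 - \<delta>) / 2)" for n :: nat
  have [measurable]: "X n j i \<in> borel_measurable M" for n j i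
    using bounded_centred_iid.X_measurable[OF iid] .
  define A where "A n j = {\<omega> \<in> space M. t n \<le> \<bar>\<Sum>i<n. X n j i \<omega>\<bar>}" for n j
  have [measurable]: "A n j \<in> sets M" for n j unfolding A_def by measurable
  have "(\<lambda>n. s n) \<longlonglongrightarrow> 0" unfolding s_def using \<delta> by real_asymp
  then have s_small: "eventually (\<lambda>n. s n < 1 / 2) sequentially" by (rule order_tendstoD) simp
  have bound: "eventually (\<lambda>n. prob (\<Union>j\<le>n. A n j) \<le> real (n + 1) * (2 * exp (2 - real n powr (1 / 10)))) sequentially"
    using s_small eventually_gt_at_top[of 0]
  proof eventually_elim
    case (elim n)
    have s0: "0 \<le> s n" by (simp add: s_def)
    have st: "s n * t n = real n powr (1 / 10)"
      unfolding s_def t_def by (simp add: powr_add[symmetric] field_simps)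
    have nsd: "real n * (s n)\<^sup>2 * real n powr (- \<delta>) = 1"
    proof -
      have "real n * (s n)\<^sup>2 * real n powr (- \<delta>) = real n powr 1 * (real n powr (- (1 - \<delta>) / 2) * real n powr (- (1 - \<delta>) / 2)) * real n powr (- \<delta>)"
        using elim by (simp add: s_def power2_eq_square)
      also have "\<dots> = real n powr 0" by (simp only: powr_add[symmetric]) simp
      finally show ?thesis using elim by simp
    qed
    have "prob (A n j) \<le> 2 * exp (2 - real n powr (1 / 10))" if "j \<le> n" for j
    proof -
      interpret Y: bounded_centred_iid M "X n j" 2 by (rule iid)
      have "exp (s n * 2) \<le> exp 1" using elim by simp
      also have "exp 1 \<le> (4 :: real)" using exp_le by simp
      finally have e: "exp (s n * 2) \<le> 4" .
      have "real n * ((s n)\<^sup>2 * Y.v / 2 * exp (s n * 2)) \<le> real n * ((s n)\<^sup>2 * real n powr (- \<delta>) / 2 * 4)"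
        using var[OF elim(2) that] e Y.v_nonneg by (intro mult_left_mono mult_mono divide_right_mono) auto
      also have "\<dots> = 2 * (real n * (s n)\<^sup>2 * real n powr (- \<delta>))" by simp
      finally have "real n * ((s n)\<^sup>2 * Y.v / 2 * exp (s n * 2)) - s n * t n \<le> 2 - real n powr (1 / 10)"
        unfolding nsd st by simp
      then have "2 * exp (real n * ((s n)\<^sup>2 * Y.v / 2 * exp (s n * 2)) - s n * t n) \<le> 2 * exp (2 - real n powr (1 / 10))"
        by simp
      with Y.abs_tail[OF s0, of "t n" n] show ?thesis
        unfolding A_def Y.S_def by linarith
    qed
    then have "(\<Sum>j\<le>n. prob (A n j)) \<le> (\<Sum>j\<le>n. 2 * exp (2 - real n powr (1 / 10)))"
      by (intro sum_mono) simp
    moreover have "prob (\<Union>j\<le>n. A n j) \<le> (\<Sum>j\<le>n. prob (A n j))"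
      by (rule finite_measure_subadditive_finite) auto
    ultimately show ?case by simp
  qed
  have "eventually (\<lambda>n. real (n + 1) * (2 * exp (2 - real n powr (1 / 10))) \<le> real n powr (-2)) sequentially"
    by real_asymp
  with bound have bound': "eventually (\<lambda>n. norm (prob (\<Union>j\<le>n. A n j)) \<le> real n powr (-2)) sequentially"
    by eventually_elim simp
  have "summable (\<lambda>n. prob (\<Union>j\<le>n. A n j))"
    by (rule summable_comparison_test_ev[OF bound']) (simp add: summable_real_powr_iff)
  then have "AE \<omega> in M. eventually (\<lambda>n. \<omega> \<in> space M - (\<Union>j\<le>n. A n j)) sequentially"
    by (intro borel_cantelli_AE1) (auto simp: less_top[symmetric])
  then show ?thesis
    by eventually_elim (auto elim!: eventually_mono simp: A_def t_def not_le intro: less_imp_le)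
qed

lemma (in prob_space) AE_tendsto_0_imp_small_o_p_1:
  fixes X :: "nat \<Rightarrow> 'a \<Rightarrow> real"
  assumes [measurable]: "\<And>n. X n \<in> borel_measurable M"
    and lim: "AE \<omega> in M. (\<lambda>n. X n \<omega>) \<longlonglongrightarrow> 0"
  shows "small_o_p_1 X"
  unfolding small_o_p_1_def
proof (intro conjI allI impI)
  fix \<epsilon> :: real assume "\<epsilon> > 0"
  have "(\<lambda>n. expectation (indicator {\<omega> \<in> space M. \<bar>X n \<omega>\<bar> > \<epsilon>} :: 'a \<Rightarrow> real)) \<longlonglongrightarrow> expectation (\<lambda>\<omega>. 0)"
  proof (rule integral_dominated_convergence[where w = "\<lambda>_. 1"])
    show "AE \<omega> in M. (\<lambda>n. indicator {\<omega> \<in> space M. \<bar>X n \<omega>\<bar> > \<epsilon>} \<omega> :: real) \<longlonglongrightarrow> 0"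
      using lim
    proof eventually_elim
      case (elim \<omega>)
      have "eventually (\<lambda>n. \<bar>X n \<omega>\<bar> < \<epsilon>) sequentially"
        by (rule order_tendstoD[OF tendsto_rabs_zero[OF elim]]) (rule \<open>\<epsilon> > 0\<close>)
      then have "eventually (\<lambda>n. indicator {\<omega> \<in> space M. \<bar>X n \<omega>\<bar> > \<epsilon>} \<omega> = (0 :: real)) sequentially"
        by eventually_elim simp
      then show ?case by (rule tendsto_eventually)
    qed
  qed auto
  then show "(\<lambda>n. \<P>(\<omega> in M. \<bar>X n \<omega>\<bar> > \<epsilon>)) \<longlonglongrightarrow> 0" by simp
qed auto

section \<open>The BH procedure as a level crossing\<close>

definition count_le :: "(nat \<Rightarrow> real) \<Rightarrow> nat \<Rightarrow> real \<Rightarrow> nat" where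
  "count_le x n t = card {i. i < n \<and> x i \<le> t}"

lemma count_le_bound: "count_le x n t \<le> n"
  unfolding count_le_def using card_mono[of "{..<n}" "{i. i < n \<and> x i \<le> t}"] by auto

lemma count_le_mono: "s \<le> t \<Longrightarrow> count_le x n s \<le> count_le x n t"
  unfolding count_le_def by (rule card_mono) auto

text \<open>
  This turns the step-up rule for the sorted p-values into a condition on the empirical distribution
  function.  In the sorted list, the entries \<open>\<le> t\<close> form an initial segment.
\<close>

lemma order_stat_le_iff:
  assumes "1 \<le> j" "j \<le> n"
  shows "order_stat x n j \<le> t \<longleftrightarrow> j \<le> count_le x n t"
proof -
  define ys where "ys = sort (map x [0..<n])"
  have len: "length ys = n" and srt: "sorted ys" by (simp_all add: ys_def)
  define I where "I = {k. k < n \<and> ys ! k \<le> t}"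
  have "count_le x n t = length (filter (\<lambda>y. y \<le> t) (map x [0..<n]))"
    unfolding count_le_def length_filter_conv_card by (rule arg_cong[where f = card]) auto
  also have "\<dots> = size (filter_mset (\<lambda>y. y \<le> t) (mset (map x [0..<n])))"
    by (metis mset_filter size_mset)
  also have "mset (map x [0..<n]) = mset ys" by (simp add: ys_def del: mset_map)
  also have "size (filter_mset (\<lambda>y. y \<le> t) (mset ys)) = length (filter (\<lambda>y. y \<le> t) ys)"
    by (metis mset_filter size_mset)
  also have "\<dots> = card I" unfolding length_filter_conv_card I_def len ..
  finally have count: "count_le x n t = card I" .
  have "ys ! (j - 1) \<le> t \<longleftrightarrow> j \<le> card I"
  proof
    assume *: "ys ! (j - 1) \<le> t"
    have "{..<j} \<subseteq> I"
    proof
      fix k assume "k \<in> {..<j}"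
      then have "ys ! k \<le> ys ! (j - 1)" using sorted_nth_mono[OF srt, of k "j - 1"] assms len by auto
      then show "k \<in> I" using * \<open>k \<in> {..<j}\<close> assms by (auto simp: I_def)
    qed
    then have "card {..<j} \<le> card I" by (rule card_mono[rotated]) (auto simp: I_def)
    then show "j \<le> card I" by simp
  next
    assume *: "j \<le> card I"
    show "ys ! (j - 1) \<le> t"
    proof (rule ccontr)
      assume **: "\<not> ys ! (j - 1) \<le> t"
      have "I \<subseteq> {..<j - 1}"
      proof
        fix k assume k: "k \<in> I"
        show "k \<in> {..<j - 1}"
        proof (rule ccontr)
          assume "k \<notin> {..<j - 1}"
          then have "ys ! (j - 1) \<le> ys ! k" using sorted_nth_mono[OF srt, of "j - 1" k] k len by (auto simp: I_def)
          with k ** show False by (auto simp: I_def)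
        qed
      qed
      then have "card I \<le> card {..<j - 1}" by (rule card_mono[rotated]) auto
      with * assms show False by simp
    qed
  qed
  then show ?thesis using assms by (simp add: order_stat_def ys_def count)
qed

lemma bh_rejections_eq:
  "bh_rejections \<alpha> x n = Max {j. j \<le> n \<and> j \<le> count_le x n (\<alpha> * real j / real n)}"
proof -
  have "{j \<in> {0..n}. order_stat x n j \<le> \<alpha> * real j / real n} = {j. j \<le> n \<and> j \<le> count_le x n (\<alpha> * real j / real n)}"
    (is "?A = ?B")
  proof (rule set_eqI)
    fix j show "j \<in> ?A \<longleftrightarrow> j \<in> ?B"
      by (cases "j = 0") (auto simp: order_stat_def[of x n 0] order_stat_le_iff)
  qed
  then show ?thesis by (simp add: bh_rejections_def)
qed

context
  fixes \<alpha> :: real and x :: "nat \<Rightarrow> real" and n :: nat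
  assumes \<alpha>: "0 \<le> \<alpha>"
begin

lemma bh_rejections_le: "bh_rejections \<alpha> x n \<le> n"
  and bh_rejections_self: "bh_rejections \<alpha> x n \<le> count_le x n (\<alpha> * bh_rejections \<alpha> x n / n)"
  and bh_rejections_greatest: "j \<le> n \<Longrightarrow> j \<le> count_le x n (\<alpha> * j / n) \<Longrightarrow> j \<le> bh_rejections \<alpha> x n"
proof -
  let ?A = "{j. j \<le> n \<and> j \<le> count_le x n (\<alpha> * real j / real n)}"
  have fin: "finite ?A" by simp
  have "Max ?A \<in> ?A" by (rule Max_in[OF fin]) (auto intro: exI[of _ 0])
  then show "bh_rejections \<alpha> x n \<le> n" "bh_rejections \<alpha> x n \<le> count_le x n (\<alpha> * bh_rejections \<alpha> x n / n)"
    by (simp_all add: bh_rejections_eq)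
  show "j \<le> n \<Longrightarrow> j \<le> count_le x n (\<alpha> * j / n) \<Longrightarrow> j \<le> bh_rejections \<alpha> x n"
    unfolding bh_rejections_eq by (rule Max_ge[OF fin]) simp
qed

text \<open>
  If the count at \<open>\<alpha> R / n\<close> were at least \<open>R + 1\<close>, the larger threshold \<open>\<alpha> (R + 1) / n\<close> would show that
  \<open>R + 1\<close> rejections are admissible.
\<close>

lemma count_le_bh_threshold: "count_le x n (\<alpha> * bh_rejections \<alpha> x n / n) = bh_rejections \<alpha> x n"
proof (rule antisym[OF _ bh_rejections_self], rule ccontr)
  let ?R = "bh_rejections \<alpha> x n"
  assume "\<not> count_le x n (\<alpha> * ?R / n) \<le> ?R"
  then have *: "Suc ?R \<le> count_le x n (\<alpha> * ?R / n)" by simp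
  also have "\<dots> \<le> count_le x n (\<alpha> * Suc ?R / n)"
    by (intro count_le_mono divide_right_mono mult_left_mono) (use \<alpha> in auto)
  finally have "Suc ?R \<le> ?R"
    by (intro bh_rejections_greatest) (use * count_le_bound[of x n] in \<open>auto intro: order.trans\<close>)
  then show False by simp
qed

text \<open>
  The left set is contained in the right one and has at least \<open>R\<close> elements, whereas the right one
  has exactly \<open>R\<close>.
\<close>

lemma bh_rejected_set:
  "{j. j < n \<and> x j \<le> order_stat x n (bh_rejections \<alpha> x n)} = {j. j < n \<and> x j \<le> \<alpha> * bh_rejections \<alpha> x n / n}"
proof (cases "bh_rejections \<alpha> x n = 0")
  case False
  let ?R = "bh_rejections \<alpha> x n"
  have R: "1 \<le> ?R" "?R \<le> n" using False bh_rejections_le by auto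
  have "order_stat x n ?R \<le> \<alpha> * ?R / n"
    using order_stat_le_iff[OF R] bh_rejections_self by simp
  moreover have "?R \<le> count_le x n (order_stat x n ?R)"
    using order_stat_le_iff[OF R] by blast
  then have "card {j. j < n \<and> x j \<le> \<alpha> * ?R / n} \<le> card {j. j < n \<and> x j \<le> order_stat x n ?R}"
    using count_le_bh_threshold by (simp add: count_le_def)
  ultimately show ?thesis
    by (intro card_seteq) auto
qed (simp add: order_stat_def)

lemma bh_power_eq:
  "bh_power \<alpha> x t n =
     card {j. j < n \<and> x j \<le> \<alpha> * bh_rejections \<alpha> x n / n \<and> t j} / max (card {j. j < n \<and> t j}) 1"
proof -
  let ?u = "\<alpha> * bh_rejections \<alpha> x n / n"
  have "card {j. j < n \<and> x j \<le> ?u} = card {j. j < n \<and> x j \<le> ?u \<and> t j} + card {j. j < n \<and> x j \<le> ?u \<and> \<not> t j}"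
    by (subst card_Un_disjoint[symmetric]) (auto intro!: arg_cong[where f = card])
  moreover have "card {j. j < n \<and> x j \<le> ?u} = bh_rejections \<alpha> x n"
    using count_le_bh_threshold by (simp add: count_le_def)
  moreover have "bh_false_rejections \<alpha> x t n = card {j. j < n \<and> x j \<le> ?u \<and> \<not> t j}"
    unfolding bh_false_rejections_def using bh_rejected_set by (intro arg_cong[where f = card]) auto
  ultimately have 1: "real (bh_rejections \<alpha> x n) - real (bh_false_rejections \<alpha> x t n) = card {j. j < n \<and> x j \<le> ?u \<and> t j}"
    by simp
  have "{..<n} = {j. j < n \<and> t j} \<union> {j. j < n \<and> \<not> t j}" by auto
  then have "card {..<n} = card {j. j < n \<and> t j} + card {j. j < n \<and> \<not> t j}"
    using card_Un_disjoint[of "{j. j < n \<and> t j}" "{j. j < n \<and> \<not> t j}"] by auto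
  then have 2: "n - num_true_nulls t n = card {j. j < n \<and> t j}"
    by (simp add: num_true_nulls_def)
  show ?thesis unfolding bh_power_def 1 2 by simp
qed

end

section \<open>Perturbation of the crossing\<close>

text \<open>
  A finite limsup of \<open>A\<close> and of \<open>- A\<close> makes \<open>A\<close> eventually bounded, so replacing \<open>c n\<close> by its limit changes
  the sequence only by a null sequence.
\<close>

lemma limsup_perturbed_scaling:
  fixes A e c :: "nat \<Rightarrow> real"
  assumes up: "limsup (\<lambda>n. ereal (A n)) = ereal L" and low: "limsup (\<lambda>n. ereal (- A n)) = ereal L'"
    and e: "e \<longlonglongrightarrow> 0" and c: "c \<longlonglongrightarrow> C" "C > 0"
  shows "limsup (\<lambda>n. ereal (c n * (A n + e n))) = ereal (C * L)"
proof -
  have "eventually (\<lambda>n. ereal (A n) < ereal (L + 1)) sequentially" "eventually (\<lambda>n. ereal (- A n) < ereal (L' + 1)) sequentially"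
    by (rule Limsup_lessD, simp add: up low)+
  then have bnd: "eventually (\<lambda>n. \<bar>A n\<bar> \<le> \<bar>L\<bar> + \<bar>L'\<bar> + 1) sequentially"
    by eventually_elim auto
  have "(\<lambda>n. A n * (c n - C)) \<longlonglongrightarrow> 0"
  proof (rule Lim_null_comparison)
    show "eventually (\<lambda>n. norm (A n * (c n - C)) \<le> (\<bar>L\<bar> + \<bar>L'\<bar> + 1) * \<bar>c n - C\<bar>) sequentially"
      using bnd by eventually_elim (auto simp: abs_mult intro!: mult_right_mono)
    show "(\<lambda>n. (\<bar>L\<bar> + \<bar>L'\<bar> + 1) * \<bar>c n - C\<bar>) \<longlonglongrightarrow> 0"
      using c(1) by (intro tendsto_mult_right_zero tendsto_rabs_zero) (simp add: LIM_zero_iff)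
  qed
  moreover have "(\<lambda>n. c n * e n) \<longlonglongrightarrow> C * 0" by (intro tendsto_intros e c)
  ultimately have "(\<lambda>n. A n * (c n - C) + c n * e n) \<longlonglongrightarrow> 0 + C * 0" by (rule tendsto_add)
  then have "(\<lambda>n. ereal (A n * (c n - C) + c n * e n)) \<longlonglongrightarrow> ereal 0" by simp
  from ereal_limsup_lim_add[OF this, of "\<lambda>n. ereal (C * A n)"]
  have "limsup (\<lambda>n. ereal (A n * (c n - C) + c n * e n) + ereal (C * A n)) = limsup (\<lambda>n. ereal C * ereal (A n))"
    by simp
  also have "\<dots> = ereal C * limsup (\<lambda>n. ereal (A n))"
    using c by (intro limsup_ereal_mult_left) auto
  finally show ?thesis by (simp add: up algebra_simps)
qed

text \<open>
  What the asymptotics of \<open>R\<^sub>n\<close> uses about the distribution function; the arguments in this locale are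
  deterministic, for one fixed sequence of p-values.  Transversality of the crossing is \<open>slope\<close>, and
  \<open>us < \<alpha>\<close> expresses \<open>p\<^sub>* < 1\<close>.
\<close>

locale bh_crossing =
  fixes F :: "real \<Rightarrow> real" and \<alpha> us d :: real
  assumes \<alpha>_range: "0 < \<alpha>" "\<alpha> < 1"
    and us_range: "0 < us" "us < \<alpha>"
    and crossing: "F us = us / \<alpha>"
    and above: "\<And>u. us < u \<Longrightarrow> u \<le> 1 \<Longrightarrow> F u < u / \<alpha>"
    and F_cont: "continuous_on {0..1} F"
    and F_deriv: "(F has_real_derivative d) (at us)"
    and slope: "\<alpha> * d < 1"
begin

definition h :: "real \<Rightarrow> real" where "h u = F u - u / \<alpha>"

lemma h_us: "h us = 0" by (simp add: h_def crossing)

lemma h_cont: "continuous_on {0..1} h"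
  unfolding h_def by (intro continuous_intros F_cont) (use \<alpha>_range in auto)

lemma h_deriv: "(h has_real_derivative (d - 1 / \<alpha>)) (at us)"
  unfolding h_def[abs_def] by (intro DERIV_diff F_deriv DERIV_cdivide DERIV_ident)

lemma h_deriv_neg: "d - 1 / \<alpha> < 0"
  using slope \<alpha>_range by (simp add: field_simps)

lemma F_isCont: "0 < u \<Longrightarrow> u < 1 \<Longrightarrow> isCont F u"
  using continuous_on_interior[OF F_cont, of u] by simp

context
  fixes x :: "nat \<Rightarrow> real"
  assumes uniform: "eventually (\<lambda>n. \<forall>j\<le>n. \<bar>count_le x n (\<alpha> * j / n) - n * F (\<alpha> * j / n)\<bar> \<le> n powr (3/5)) sequentially"
begin

definition R :: "nat \<Rightarrow> nat" where "R n = bh_rejections \<alpha> x n"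
definition u :: "nat \<Rightarrow> real" where "u n = \<alpha> * R n / n"

lemma u_range: "0 \<le> u n" "u n \<le> \<alpha>"
proof -
  have "real (R n) / n \<le> 1" using bh_rejections_le[of \<alpha> x n] \<alpha>_range by (simp add: R_def divide_le_eq)
  then have "\<alpha> * (R n / n) \<le> \<alpha> * 1" using \<alpha>_range by (intro mult_left_mono) auto
  then show "u n \<le> \<alpha>" by (simp add: u_def)
qed (use \<alpha>_range in \<open>simp add: u_def\<close>)

lemma count_le_u: "count_le x n (u n) = R n"
  using count_le_bh_threshold[of \<alpha> x n] \<alpha>_range by (simp add: u_def R_def)

text \<open>
  At \<open>u n\<close> the empirical count lies exactly on the line, so \<open>h (u n)\<close> is the deviation of the empirical
  from the true distribution function, for which the grid bound holds.
\<close>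

lemma h_u_small: "eventually (\<lambda>n. \<bar>h (u n)\<bar> \<le> n powr (-2/5)) sequentially"
  using uniform eventually_gt_at_top[of 0]
proof eventually_elim
  case (elim n)
  have Rn: "R n \<le> n" using bh_rejections_le[of \<alpha> x n] \<alpha>_range by (simp add: R_def)
  have "\<bar>real (R n) - n * F (u n)\<bar> \<le> n powr (3/5)"
    using elim(1) Rn count_le_u[of n] unfolding u_def by auto
  moreover have "real (R n) - n * F (u n) = - (n * h (u n))"
    using elim \<alpha>_range by (simp add: h_def u_def field_simps)
  ultimately have "n * \<bar>h (u n)\<bar> \<le> n powr (3/5)" by (simp add: abs_mult)
  also have "n powr (3/5) = n * n powr (-2/5)"
    using powr_add[of "real n" 1 "-2/5"] elim by simp
  finally show ?case using elim by simp
qed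

text \<open>
  By compactness \<open>h\<close> is bounded away from 0 on \<open>[us + \<delta>, 1]\<close>, whereas \<open>h (u n) \<longlonglongrightarrow> 0\<close>.
\<close>

lemma u_upper:
  assumes "\<delta> > 0"
  shows "eventually (\<lambda>n. u n < us + \<delta>) sequentially"
proof (cases "us + \<delta> \<le> 1")
  case True
  have "continuous_on {us + \<delta>..1} h" by (rule continuous_on_subset[OF h_cont]) (use us_range assms in auto)
  then obtain z where z: "z \<in> {us + \<delta>..1}" "\<And>y. y \<in> {us + \<delta>..1} \<Longrightarrow> h y \<le> h z"
    using continuous_attains_sup[of "{us + \<delta>..1}" h] True by auto
  have hz: "h z < 0" using above[of z] z(1) assms by (simp add: h_def)
  have "eventually (\<lambda>n. real n powr (-2/5) < - h z) sequentially"
    using hz by (intro order_tendstoD(2)[of _ 0]) (real_asymp | simp)+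
  with h_u_small show ?thesis
  proof eventually_elim
    case (elim n)
    show ?case
    proof (rule ccontr)
      assume "\<not> u n < us + \<delta>"
      then have "h (u n) \<le> h z" using z(2)[of "u n"] u_range[of n] \<alpha>_range by auto
      with elim show False by linarith
    qed
  qed
next
  case False
  have "u n < us + \<delta>" for n using False u_range(2)[of n] \<alpha>_range by linarith
  then show ?thesis by simp
qed

text \<open>
  Just to the left of \<open>us\<close> there is a point \<open>u0\<close> with \<open>h u0 > 0\<close>.  The nearest grid point above it is then
  admissible for the BH procedure, as soon as the uniform error divided by \<open>n\<close> is smaller than the value
  of \<open>h\<close> there.
\<close>

lemma u_lower:
  assumes "\<delta> > 0"
  shows "eventually (\<lambda>n. us - \<delta> < u n) sequentially"
proof -
  obtain e where e: "e > 0" "\<And>k. 0 < k \<Longrightarrow> k < e \<Longrightarrow> h us < h (us - k)"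
    using DERIV_neg_dec_left[OF h_deriv h_deriv_neg] by auto
  define k where "k = min (min e \<delta>) us / 2"
  have k: "0 < k" "k < e" "k < \<delta>" "k < us" using e us_range assms by (auto simp: k_def)
  define u0 where "u0 = us - k"
  have u0: "0 < u0" "u0 < us" "h u0 > 0" using k e h_us by (auto simp: u0_def)
  define j where "j n = nat \<lceil>n * u0 / \<alpha>\<rceil>" for n :: nat
  have j_low: "n * u0 / \<alpha> \<le> j n" and j_high: "j n \<le> n * u0 / \<alpha> + 1" for n
    unfolding j_def using u0 \<alpha>_range by (auto simp: of_nat_nat real_nat_ceiling_ge intro!: order.trans[OF _ ceiling_mono[of 0]])
  have grid: "(\<lambda>n. \<alpha> * j n / n) \<longlonglongrightarrow> u0"
  proof (rule tendsto_sandwich)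
    show "eventually (\<lambda>n. u0 \<le> \<alpha> * j n / n) sequentially"
      using eventually_gt_at_top[of 0]
    proof eventually_elim
      case (elim n)
      then show ?case using j_low[of n] \<alpha>_range by (simp add: field_simps)
    qed
    show "eventually (\<lambda>n. \<alpha> * j n / n \<le> u0 + \<alpha> / n) sequentially"
      using eventually_gt_at_top[of 0]
    proof eventually_elim
      case (elim n)
      then show ?case using j_high[of n] \<alpha>_range by (simp add: field_simps)
    qed
    show "(\<lambda>n. u0 + \<alpha> / real n) \<longlonglongrightarrow> u0" by real_asymp
  qed simp
  have "isCont h u0" using continuous_on_interior[OF h_cont, of u0] u0 us_range \<alpha>_range by simp
  from isCont_tendsto_compose[OF this grid]
  have "(\<lambda>n. h (\<alpha> * j n / n)) \<longlonglongrightarrow> h u0" .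
  moreover have "(\<lambda>n. real n powr (-2/5)) \<longlonglongrightarrow> 0" by real_asymp
  ultimately have "(\<lambda>n. h (\<alpha> * j n / n) - real n powr (-2/5)) \<longlonglongrightarrow> h u0 - 0" by (rule tendsto_diff)
  then have ev1: "eventually (\<lambda>n. h (\<alpha> * j n / n) - real n powr (-2/5) > 0) sequentially"
    by (rule order_tendstoD) (use u0 in simp)
  have "eventually (\<lambda>n. \<alpha> * j n / n < us) sequentially"
    by (rule order_tendstoD[OF grid]) (use u0 in simp)
  with ev1 uniform show ?thesis using eventually_gt_at_top[of 0]
  proof eventually_elim
    case (elim n)
    have "\<alpha> * (real (j n) / n) < \<alpha> * 1" using elim(3) us_range by simp
    then have "real (j n) / n < 1" using \<alpha>_range by (simp only: mult_less_cancel_left_pos)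
    then have jn: "j n \<le> n" using elim by simp
    have "real (j n) + n * (h (\<alpha> * j n / n) - n powr (-2/5)) = n * F (\<alpha> * j n / n) - n * n powr (-2/5)"
      using elim \<alpha>_range by (simp add: h_def field_simps)
    also have "n * n powr (-2/5) = n powr (3/5)"
      using powr_add[of "real n" 1 "-2/5"] elim by simp
    finally have "real (j n) \<le> n * F (\<alpha> * j n / n) - n powr (3/5)"
      using elim by (smt (verit) mult_pos_pos of_nat_0_less_iff)
    also have "\<dots> \<le> count_le x n (\<alpha> * j n / n)" using elim(2) jn by (smt (verit))
    finally have "j n \<le> R n"
      unfolding R_def using jn \<alpha>_range by (intro bh_rejections_greatest) auto
    then have "\<alpha> * (j n) / n \<le> u n"
      unfolding u_def using \<alpha>_range by (intro divide_right_mono mult_left_mono) auto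
    moreover have "u0 \<le> \<alpha> * j n / n" using j_low[of n] elim \<alpha>_range by (simp add: field_simps)
    ultimately show ?case using k by (simp add: u0_def)
  qed
qed

lemma u_tendsto: "u \<longlonglongrightarrow> us"
proof (rule order_tendstoI)
  fix a assume "a < us"
  then show "eventually (\<lambda>n. a < u n) sequentially" using u_lower[of "us - a"] by simp
next
  fix a assume "us < a"
  then show "eventually (\<lambda>n. u n < a) sequentially" using u_upper[of "a - us"] by simp
qed

lemma R_tendsto: "(\<lambda>n. R n / n) \<longlonglongrightarrow> us / \<alpha>"
proof -
  have "(\<lambda>n. u n / \<alpha>) \<longlonglongrightarrow> us / \<alpha>" by (intro tendsto_intros u_tendsto) (use \<alpha>_range in auto)
  then show ?thesis using \<alpha>_range by (simp add: u_def)
qed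

text \<open>
  With \<open>h z = k z * (z - us)\<close> and \<open>n (u n - us) = \<alpha> r\<close> for \<open>r = R n - n F(us)\<close>, the relation
  \<open>N\<^sub>n(u n) = R n\<close> becomes a linear equation for \<open>r\<close> with leading coefficient
  \<open>- \<alpha> k (u n) \<longlonglongrightarrow> 1 - \<alpha> d\<close>.  To apply the local bound on the increment, \<open>F (u n)\<close> must be within
  \<open>n\<^sup>-\<^sup>7\<^sup>/\<^sup>2\<^sup>0\<close> of \<open>F us\<close>; it is within a constant multiple of \<open>n\<^sup>-\<^sup>2\<^sup>/\<^sup>5\<close>, and the slightly weaker exponent
  absorbs the constant.
\<close>

lemma R_decomposition:
  assumes local: "eventually (\<lambda>n. \<forall>j\<le>n. \<bar>F (\<alpha> * j / n) - F us\<bar> \<le> n powr (-7/20) \<longrightarrow>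
      \<bar>real (count_le x n (\<alpha> * j / n)) - count_le x n us - n * (F (\<alpha> * j / n) - F us)\<bar> \<le> n powr (17/40)) sequentially"
  obtains c e where "c \<longlonglongrightarrow> 1 / (1 - \<alpha> * d)"
    "eventually (\<lambda>n. \<bar>e n\<bar> \<le> n powr (17/40)) sequentially"
    "eventually (\<lambda>n. R n - n * F us = c n * ((count_le x n us - n * F us) + e n)) sequentially"
proof -
  obtain k where k: "\<And>z. h z - h us = k z * (z - us)" "isCont k us" "k us = d - 1 / \<alpha>"
    using h_deriv unfolding CARAT_DERIV by blast
  have k_lim: "(\<lambda>n. k (u n)) \<longlonglongrightarrow> d - 1 / \<alpha>"
    using isCont_tendsto_compose[OF k(2) u_tendsto] k(3) by simp
  have hk: "h (u n) = k (u n) * (u n - us)" for n using k(1)[of "u n"] h_us by simp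
  define c where "c n = 1 / (- \<alpha> * k (u n))" for n
  define e where "e n = real (R n) - count_le x n us - n * (F (u n) - F us)" for n
  have ak: "- \<alpha> * (d - 1 / \<alpha>) = 1 - \<alpha> * d" using \<alpha>_range by (simp add: field_simps)
  have "c \<longlonglongrightarrow> 1 / (- \<alpha> * (d - 1 / \<alpha>))"
    unfolding c_def by (intro tendsto_intros k_lim) (use \<alpha>_range h_deriv_neg in auto)
  then have c_lim: "c \<longlonglongrightarrow> 1 / (1 - \<alpha> * d)" unfolding ak .
  \<comment> \<open>Half the absolute slope of \<open>h\<close> at the crossing.\<close>
  define \<kappa> where "\<kappa> = (1 / \<alpha> - d) / 2"
  have \<kappa>: "\<kappa> > 0" using h_deriv_neg by (simp add: \<kappa>_def)
  have k_neg: "eventually (\<lambda>n. k (u n) < - \<kappa>) sequentially"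
    by (rule order_tendstoD[OF k_lim]) (use h_deriv_neg in \<open>simp add: \<kappa>_def field_simps\<close>)
  have "eventually (\<lambda>n. (1 + 1 / (\<alpha> * \<kappa>)) * real n powr (-2/5) \<le> real n powr (-7/20)) sequentially"
    by real_asymp
  with h_u_small k_neg have close: "eventually (\<lambda>n. \<bar>F (u n) - F us\<bar> \<le> n powr (-7/20)) sequentially"
  proof eventually_elim
    case (elim n)
    have "\<kappa> * \<bar>u n - us\<bar> \<le> \<bar>k (u n)\<bar> * \<bar>u n - us\<bar>" using elim by (intro mult_right_mono) auto
    also have "\<dots> = \<bar>h (u n)\<bar>" by (simp add: hk abs_mult)
    also have "\<dots> \<le> n powr (-2/5)" by (rule elim)
    finally have "\<bar>u n - us\<bar> / \<alpha> \<le> 1 / (\<alpha> * \<kappa>) * n powr (-2/5)" using \<kappa> \<alpha>_range by (simp add: field_simps)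
    moreover have "F (u n) - F us = h (u n) + (u n - us) / \<alpha>"
      by (simp add: h_def crossing diff_divide_distrib)
    then have "\<bar>F (u n) - F us\<bar> \<le> \<bar>h (u n)\<bar> + \<bar>u n - us\<bar> / \<alpha>"
      using \<alpha>_range by (metis abs_triangle_ineq abs_divide abs_of_pos)
    ultimately show ?case using elim by (simp add: algebra_simps)
  qed
  have e_bound: "eventually (\<lambda>n. \<bar>e n\<bar> \<le> n powr (17/40)) sequentially"
    using local close
  proof eventually_elim
    case (elim n)
    have "R n \<le> n" using bh_rejections_le[of \<alpha> x n] \<alpha>_range by (simp add: R_def)
    with elim have "\<bar>real (count_le x n (u n)) - count_le x n us - n * (F (u n) - F us)\<bar> \<le> n powr (17/40)"
      unfolding u_def by blast
    then show ?case by (simp add: e_def count_le_u)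
  qed
  have "eventually (\<lambda>n. R n - n * F us = c n * ((count_le x n us - n * F us) + e n)) sequentially"
    using k_neg eventually_gt_at_top[of 0]
  proof eventually_elim
    case (elim n)
    let ?r = "R n - n * F us"
    have r: "n * (u n - us) = \<alpha> * ?r" using elim \<alpha>_range by (simp add: u_def crossing field_simps)
    have "F (u n) - F us = (u n - us) * k (u n) + (u n - us) / \<alpha>"
      using hk[of n] by (simp add: h_def crossing diff_divide_distrib algebra_simps)
    then have "n * (F (u n) - F us) = n * ((u n - us) * k (u n) + (u n - us) / \<alpha>)"
      by (rule arg_cong)
    also have "\<dots> = n * (u n - us) * k (u n) + n * (u n - us) / \<alpha>"
      by (simp add: distrib_left)
    also have "\<dots> = \<alpha> * ?r * k (u n) + ?r" unfolding r using \<alpha>_range by simp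
    finally have "count_le x n us - n * F us + e n = - \<alpha> * k (u n) * ?r"
      unfolding e_def by (simp add: algebra_simps)
    moreover have "- \<alpha> * k (u n) \<noteq> 0" using elim \<kappa> \<alpha>_range by auto
    ultimately show ?case by (simp add: c_def)
  qed
  with c_lim e_bound show thesis by (rule that)
qed

text \<open>
  The error exponent \<open>17 / 40\<close> is below \<open>1 / 2\<close>, so \<open>e\<close> disappears on the scale \<open>\<surd>(n ln ln n)\<close>.
\<close>

lemma limsup_R:
  assumes local: "eventually (\<lambda>n. \<forall>j\<le>n. \<bar>F (\<alpha> * j / n) - F us\<bar> \<le> n powr (-7/20) \<longrightarrow>
      \<bar>real (count_le x n (\<alpha> * j / n)) - count_le x n us - n * (F (\<alpha> * j / n) - F us)\<bar> \<le> n powr (17/40)) sequentially"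
    and up: "limsup (\<lambda>n. ereal ((count_le x n us - n * F us) / sqrt (n * ln (ln n)))) = ereal L"
    and low: "limsup (\<lambda>n. ereal (- ((count_le x n us - n * F us) / sqrt (n * ln (ln n))))) = ereal L"
  shows "limsup (\<lambda>n. ereal ((R n - n * F us) / sqrt (n * ln (ln n)))) = ereal (L / (1 - \<alpha> * d))"
    and "limsup (\<lambda>n. ereal (- ((R n - n * F us) / sqrt (n * ln (ln n))))) = ereal (L / (1 - \<alpha> * d))"
proof -
  obtain c e where c: "c \<longlonglongrightarrow> 1 / (1 - \<alpha> * d)"
    and e: "eventually (\<lambda>n. \<bar>e n\<bar> \<le> n powr (17/40)) sequentially"
    and R: "eventually (\<lambda>n. R n - n * F us = c n * ((count_le x n us - n * F us) + e n)) sequentially"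
    by (rule R_decomposition[OF local])
  define w where "w n = sqrt (real n * ln (ln (real n)))" for n
  define A where "A n = (count_le x n us - n * F us) / w n" for n
  have "(\<lambda>n. e n / w n) \<longlonglongrightarrow> 0"
  proof (rule Lim_null_comparison)
    have "eventually (\<lambda>n. w n > 0) sequentially" unfolding w_def by real_asymp
    with e show "eventually (\<lambda>n. norm (e n / w n) \<le> n powr (17/40) / w n) sequentially"
      by eventually_elim (auto intro!: divide_right_mono)
    show "(\<lambda>n. real n powr (17/40) / w n) \<longlonglongrightarrow> 0" unfolding w_def by real_asymp
  qed
  then have e0: "(\<lambda>n. e n / w n) \<longlonglongrightarrow> 0" "(\<lambda>n. - (e n / w n)) \<longlonglongrightarrow> 0" by (auto intro: tendsto_minus_cancel)
  have pos: "1 / (1 - \<alpha> * d) > 0" using slope by simp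
  have 1: "limsup (\<lambda>n. ereal (c n * (A n + e n / w n))) = ereal (1 / (1 - \<alpha> * d) * L)"
    by (rule limsup_perturbed_scaling[OF _ _ e0(1) c pos]) (use up low in \<open>simp_all add: A_def w_def\<close>)
  have 2: "limsup (\<lambda>n. ereal (c n * (- A n + - (e n / w n)))) = ereal (1 / (1 - \<alpha> * d) * L)"
    by (rule limsup_perturbed_scaling[OF _ _ e0(2) c pos]) (use up low in \<open>simp_all add: A_def w_def\<close>)
  have "eventually (\<lambda>n. ereal ((R n - n * F us) / sqrt (n * ln (ln n))) = ereal (c n * (A n + e n / w n))) sequentially"
    using R by eventually_elim (simp add: A_def w_def add_divide_distrib[symmetric])
  from Limsup_eq[OF this] 1 show "limsup (\<lambda>n. ereal ((R n - n * F us) / sqrt (n * ln (ln n)))) = ereal (L / (1 - \<alpha> * d))" by simp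
  have "eventually (\<lambda>n. ereal (- ((R n - n * F us) / sqrt (n * ln (ln n)))) = ereal (c n * (- A n + - (e n / w n)))) sequentially"
    using R
  proof eventually_elim
    case (elim n)
    show ?case unfolding elim by (simp add: A_def w_def add_divide_distrib ring_distribs)
  qed
  from Limsup_eq[OF this] 2 show "limsup (\<lambda>n. ereal (- ((R n - n * F us) / sqrt (n * ln (ln n))))) = ereal (L / (1 - \<alpha> * d))" by simp
qed

end
end

section \<open>Counts of p-values in the random effects model\<close>

lemma card_eq_sum_if:
  fixes n :: nat
  shows "real (card {i. i < n \<and> P i}) = (\<Sum>i<n. if P i then 1 else 0)"
  using sum.inter_filter[of "{..<n}" "\<lambda>_. 1 :: real" P] by simp

lemma (in prob_space) expectation_if:
  assumes "Measurable.pred M P"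
  shows "expectation (\<lambda>\<omega>. if P \<omega> then 1 else 0 :: real) = \<P>(\<omega> in M. P \<omega>)"
proof -
  have "expectation (\<lambda>\<omega>. if P \<omega> then 1 else 0 :: real) = expectation (indicator {\<omega> \<in> space M. P \<omega>})"
    by (rule Bochner_Integration.integral_cong) auto
  then show ?thesis using assms by simp
qed

lemma grid_point_in_unit_interval:
  fixes \<alpha> :: real
  assumes "0 \<le> \<alpha>" "\<alpha> \<le> 1" "j \<le> n"
  shows "\<alpha> * real j / real n \<in> {0..1}"
proof -
  have "real j / real n \<le> 1" using assms by (simp add: divide_le_eq)
  then have "\<alpha> * (real j / real n) \<le> 1 * 1" using assms by (intro mult_mono) auto
  then show ?thesis using assms by simp
qed

context random_effects_model begin

lemma pair_measurable [measurable]: "(\<lambda>\<omega>. (p j \<omega>, \<theta> j \<omega>)) \<in> M \<rightarrow>\<^sub>M borel \<Otimes>\<^sub>M count_space UNIV"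
  using indep by (auto simp: indep_vars_def)

lemma p_measurable [measurable]: "p j \<in> borel_measurable M"
  using measurable_compose[OF pair_measurable measurable_fst, of j] by (simp add: o_def)

lemma \<theta>_measurable [measurable]: "\<theta> j \<in> M \<rightarrow>\<^sub>M count_space UNIV"
  using measurable_compose[OF pair_measurable measurable_snd, of j] by (simp add: o_def)

lemma prob_p_le:
  assumes "u \<in> {0..1}"
  shows "\<P>(\<omega> in M. p j \<omega> \<le> u \<and> \<theta> j \<omega>) = \<pi> * G u"
    and "\<P>(\<omega> in M. p j \<omega> \<le> u) = mixture_cdf \<pi> G u"
proof -
  have not\<theta>: "\<P>(\<omega> in M. \<not> \<theta> j \<omega>) = 1 - \<pi>"
    using prob_neg[of "\<theta> j"] prob_false_null[of j] by simp
  show 1: "\<P>(\<omega> in M. p j \<omega> \<le> u \<and> \<theta> j \<omega>) = \<pi> * G u"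
    using alt_cdf[OF assms, of j] pi_range by (simp add: cond_prob_def prob_false_null field_simps)
  have 2: "\<P>(\<omega> in M. p j \<omega> \<le> u \<and> \<not> \<theta> j \<omega>) = (1 - \<pi>) * u"
    using null_cdf[OF assms, of j] pi_range not\<theta> by (simp add: cond_prob_def field_simps)
  have "\<P>(\<omega> in M. p j \<omega> \<le> u) = prob ({\<omega> \<in> space M. p j \<omega> \<le> u \<and> \<theta> j \<omega>} \<union> {\<omega> \<in> space M. p j \<omega> \<le> u \<and> \<not> \<theta> j \<omega>})"
    by (rule arg_cong[where f = prob]) auto
  also have "\<dots> = \<P>(\<omega> in M. p j \<omega> \<le> u \<and> \<theta> j \<omega>) + \<P>(\<omega> in M. p j \<omega> \<le> u \<and> \<not> \<theta> j \<omega>)"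
    by (rule finite_measure_Union) auto
  finally show "\<P>(\<omega> in M. p j \<omega> \<le> u) = mixture_cdf \<pi> G u"
    unfolding 1 2 by (simp add: mixture_cdf_def)
qed

lemma mixture_cdf_mono:
  assumes "0 \<le> u" "u \<le> w" "w \<le> 1"
  shows "mixture_cdf \<pi> G u \<le> mixture_cdf \<pi> G w"
proof -
  have "\<P>(\<omega> in M. p 0 \<omega> \<le> u) \<le> \<P>(\<omega> in M. p 0 \<omega> \<le> w)"
    by (intro finite_measure_mono) (use assms in auto)
  then show ?thesis using assms by (simp add: prob_p_le(2))
qed

text \<open>
  Even if all false nulls had p-value at most \<open>u\<close>, the true nulls would exceed \<open>u\<close> with probability
  \<open>(1 - \<pi>) (1 - u) > 0\<close>.
\<close>

lemma mixture_cdf_less_1: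
  assumes "0 \<le> u" "u < 1"
  shows "mixture_cdf \<pi> G u < 1"
proof -
  have "\<pi> * G u = \<P>(\<omega> in M. p 0 \<omega> \<le> u \<and> \<theta> 0 \<omega>)" using assms by (simp add: prob_p_le(1))
  also have "\<dots> \<le> \<P>(\<omega> in M. \<theta> 0 \<omega>)" by (intro finite_measure_mono) auto
  finally have "\<pi> * G u \<le> \<pi>" by (simp add: prob_false_null)
  moreover have "(1 - \<pi>) * u < (1 - \<pi>) * 1" using assms pi_range by (intro mult_strict_left_mono) auto
  ultimately show ?thesis by (simp add: mixture_cdf_def)
qed

lemma iid_functional:
  fixes f :: "real \<times> bool \<Rightarrow> real"
  assumes [measurable]: "f \<in> borel_measurable (borel \<Otimes>\<^sub>M count_space UNIV)" and f: "\<And>z. \<bar>f z\<bar> \<le> 1"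
  defines "m \<equiv> expectation (\<lambda>\<omega>. f (p 0 \<omega>, \<theta> 0 \<omega>))"
  shows "bounded_centred_iid M (\<lambda>i \<omega>. f (p i \<omega>, \<theta> i \<omega>) - m) 2"
    and "bounded_centred_iid.v M (\<lambda>i \<omega>. f (p i \<omega>, \<theta> i \<omega>) - m) = expectation (\<lambda>\<omega>. (f (p 0 \<omega>, \<theta> 0 \<omega>))\<^sup>2) - m\<^sup>2"
proof -
  have int: "integrable M (\<lambda>\<omega>. f (p 0 \<omega>, \<theta> 0 \<omega>))"
    by (rule integrable_const_bound[where B = 1]) (use f in auto)
  have int2: "integrable M (\<lambda>\<omega>. (f (p 0 \<omega>, \<theta> 0 \<omega>))\<^sup>2)"
    by (rule integrable_const_bound[where B = 1]) (use f in \<open>auto simp: abs_square_le_1\<close>)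
  have "\<bar>m\<bar> \<le> expectation (\<lambda>\<omega>. \<bar>f (p 0 \<omega>, \<theta> 0 \<omega>)\<bar>)" unfolding m_def by (rule integral_abs_bound)
  also have "\<dots> \<le> expectation (\<lambda>\<omega>. 1)" by (intro integral_mono integrable_abs int) (use f in auto)
  finally have m: "\<bar>m\<bar> \<le> 1" by (simp add: prob_space)
  show 1: "bounded_centred_iid M (\<lambda>i \<omega>. f (p i \<omega>, \<theta> i \<omega>) - m) 2"
  proof unfold_locales
    show "indep_vars (\<lambda>_. borel) (\<lambda>i \<omega>. f (p i \<omega>, \<theta> i \<omega>) - m) UNIV"
      by (rule indep_vars_compose2[OF indep, where Y = "\<lambda>_ z. f z - m"]) auto
    show "distr M borel (\<lambda>\<omega>. f (p i \<omega>, \<theta> i \<omega>) - m) = distr M borel (\<lambda>\<omega>. f (p 0 \<omega>, \<theta> 0 \<omega>) - m)" for i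
    proof -
      have *: "distr M borel (\<lambda>\<omega>. f (p i \<omega>, \<theta> i \<omega>) - m) =
          distr (distr M (borel \<Otimes>\<^sub>M count_space UNIV) (\<lambda>\<omega>. (p i \<omega>, \<theta> i \<omega>))) borel (\<lambda>z. f z - m)" for i
        by (subst distr_distr) (auto simp: o_def)
      show ?thesis by (simp only: *[of i] *[of 0] ident[of i])
    qed
    show "\<bar>f (p i \<omega>, \<theta> i \<omega>) - m\<bar> \<le> 2" for i \<omega> using f[of "(p i \<omega>, \<theta> i \<omega>)"] m by linarith
    show "expectation (\<lambda>\<omega>. f (p 0 \<omega>, \<theta> 0 \<omega>) - m) = 0"
      using int by (simp add: m_def prob_space)
  qed
  have "bounded_centred_iid.v M (\<lambda>i \<omega>. f (p i \<omega>, \<theta> i \<omega>) - m) = expectation (\<lambda>\<omega>. (f (p 0 \<omega>, \<theta> 0 \<omega>) - m)\<^sup>2)"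
    by (simp add: bounded_centred_iid.v_def[OF 1])
  also have "\<dots> = expectation (\<lambda>\<omega>. (f (p 0 \<omega>, \<theta> 0 \<omega>))\<^sup>2) - m\<^sup>2"
    unfolding m_def using int int2 by (rule variance_eq)
  finally show "bounded_centred_iid.v M (\<lambda>i \<omega>. f (p i \<omega>, \<theta> i \<omega>) - m) = expectation (\<lambda>\<omega>. (f (p 0 \<omega>, \<theta> 0 \<omega>))\<^sup>2) - m\<^sup>2" .
qed

text \<open>
  The functional \<open>f n j\<close> of a single hypothesis may depend on \<open>n\<close> and on the grid index \<open>j\<close>; the exponent
  \<open>\<delta>\<close> records how fast its second moment decays, and a smaller second moment gives a smaller error.
\<close>

lemma uniform_deviation_functional:
  fixes f :: "nat \<Rightarrow> nat \<Rightarrow> real \<times> bool \<Rightarrow> real"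
  assumes f_meas: "\<And>n j. f n j \<in> borel_measurable (borel \<Otimes>\<^sub>M count_space UNIV)"
    and f_bound: "\<And>n j z. \<bar>f n j z\<bar> \<le> 1"
    and f_var: "\<And>n j. n > 0 \<Longrightarrow> j \<le> n \<Longrightarrow> expectation (\<lambda>\<omega>. (f n j (p 0 \<omega>, \<theta> 0 \<omega>))\<^sup>2) \<le> real n powr (- \<delta>)"
    and \<delta>: "0 \<le> \<delta>" "\<delta> < 1"
  shows "AE \<omega> in M. eventually (\<lambda>n. \<forall>j\<le>n. \<bar>(\<Sum>i<n. f n j (p i \<omega>, \<theta> i \<omega>)) - n * expectation (\<lambda>\<omega>. f n j (p 0 \<omega>, \<theta> 0 \<omega>))\<bar>
      \<le> real n powr ((1 - \<delta>) / 2 + 1 / 10)) sequentially"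
proof -
  let ?m = "\<lambda>n j. expectation (\<lambda>\<omega>. f n j (p 0 \<omega>, \<theta> 0 \<omega>))"
  have "AE \<omega> in M. eventually (\<lambda>n. \<forall>j\<le>n. \<bar>\<Sum>i<n. f n j (p i \<omega>, \<theta> i \<omega>) - ?m n j\<bar> \<le> real n powr ((1 - \<delta>) / 2 + 1 / 10)) sequentially"
  proof (rule uniform_deviation[OF _ _ \<delta>])
    show "bounded_centred_iid M (\<lambda>i \<omega>. f n j (p i \<omega>, \<theta> i \<omega>) - ?m n j) 2" for n j
      by (rule iid_functional(1)[OF f_meas f_bound])
    show "bounded_centred_iid.v M (\<lambda>i \<omega>. f n j (p i \<omega>, \<theta> i \<omega>) - ?m n j) \<le> real n powr (- \<delta>)" if "n > 0" "j \<le> n" for n j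
      using f_var[OF that] unfolding iid_functional(2)[OF f_meas f_bound]
      by (smt (verit) zero_le_power2)
  qed
  then show ?thesis by (simp add: sum_subtractf)
qed

text \<open>
  The set defining \<open>us\<close> is compact, and it contains a positive point because \<open>\<alpha>\<close> exceeds \<open>\<alpha>\<^sub>*\<close>; so its
  greatest element exists and is positive.  Equality at \<open>us\<close> follows from continuity, as \<open>F\<close> lies below
  the line to the right of \<open>us\<close>.  Finally \<open>us < \<alpha>\<close>, i.e. \<open>p\<^sub>* < 1\<close>, since the true nulls keep
  \<open>F\<close> below 1 on \<open>[0, 1)\<close>.
\<close>

lemma bh_crossing_u_star:
  fixes \<alpha> :: real and F :: "real \<Rightarrow> real"
  defines "F \<equiv> mixture_cdf \<pi> G"
  defines "us \<equiv> u_star F \<alpha>"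
  assumes F_cont: "continuous_on {0..1} F"
    and F_diff: "F field_differentiable (at us)"
    and alpha: "alpha_star F < ereal \<alpha>" "\<alpha> < 1"
    and slope: "1 - \<alpha> * deriv F us > 0"
  shows "bh_crossing F \<alpha> us (deriv F us)"
proof -
  have F_prob: "F u = \<P>(\<omega> in M. p 0 \<omega> \<le> u)" if "0 \<le> u" "u \<le> 1" for u
    unfolding F_def using that by (simp add: prob_p_le(2))
  obtain w where w: "0 < w" "w \<le> 1" "ereal w / ereal (F w) < ereal \<alpha>"
    using alpha(1) unfolding alpha_star_def INF_less_iff by auto
  have Fw: "F w > 0"
  proof (rule ccontr)
    assume "\<not> F w > 0"
    moreover have "0 \<le> F w" using F_prob[of w] w by simp
    ultimately have "F w = 0" by linarith
    then show False using w by (simp add: divide_ereal_def)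
  qed
  then have "w / F w < \<alpha>" using w(3) by simp
  moreover have "0 < w / F w" using w Fw by simp
  ultimately have \<alpha>: "\<alpha> > 0" by linarith
  with \<open>w / F w < \<alpha>\<close> have w\<alpha>: "w / \<alpha> < F w" using Fw by (simp add: field_simps)
  define h where "h u = F u - u / \<alpha>" for u
  have h_cont: "continuous_on {0..1} h" unfolding h_def by (intro continuous_intros F_cont) (use \<alpha> in auto)
  define A where "A = {u. u \<in> {0..1} \<and> u / \<alpha> \<le> F u}"
  have A_eq: "A = {0..1} \<inter> h -` {0..}" by (auto simp: A_def h_def)
  have "closed A" unfolding A_eq by (intro continuous_closed_preimage h_cont) auto
  moreover have "bounded A" unfolding A_eq by (intro bounded_Int) auto
  ultimately have "compact A" by (simp add: compact_eq_bounded_closed)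
  moreover have "w \<in> A" using w w\<alpha> by (simp add: A_def)
  ultimately obtain z where z: "z \<in> A" "\<And>u. u \<in> A \<Longrightarrow> u \<le> z"
    using compact_attains_sup[of A] by blast
  have "us = z" unfolding us_def u_star_def by (rule Greatest_equality) (use z in \<open>auto simp: A_def\<close>)
  with z have us_A: "us \<in> A" and us_max: "\<And>u. u \<in> A \<Longrightarrow> u \<le> us" by auto
  have us_pos: "us > 0" using us_max[OF \<open>w \<in> A\<close>] w by simp
  have us_less: "us < 1"
  proof (rule ccontr)
    assume "\<not> us < 1"
    then have "us = 1" using us_A by (simp add: A_def)
    then have "1 / \<alpha> \<le> F 1" using us_A by (simp add: A_def)
    moreover have "F 1 \<le> 1" using F_prob[of 1] by simp
    moreover have "1 < 1 / \<alpha>" using \<alpha> alpha(2) by simp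
    ultimately show False by linarith
  qed
  have above: "F u < u / \<alpha>" if "us < u" "u \<le> 1" for u
    using us_max[of u] that us_pos by (force simp: A_def not_le)
  have crossing: "F us = us / \<alpha>"
  proof (rule ccontr)
    assume "F us \<noteq> us / \<alpha>"
    then have "h us > 0" using us_A by (simp add: A_def h_def)
    moreover have "isCont h us" using continuous_on_interior[OF h_cont, of us] us_pos us_less by simp
    ultimately have "eventually (\<lambda>u. h u > 0) (at us)"
      unfolding isCont_def by (intro order_tendstoD)
    then obtain e where e: "e > 0" "\<And>u. u \<noteq> us \<Longrightarrow> dist u us < e \<Longrightarrow> h u > 0"
      by (auto simp: eventually_at)
    define u where "u = us + min e (1 - us) / 2"
    have "u > us" "u \<le> 1" "dist u us < e" using e us_less by (auto simp: u_def dist_real_def min_def field_simps)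
    with e(2)[of u] above[of u] show False by (simp add: h_def)
  qed
  show ?thesis
  proof
    have "F us < 1" unfolding F_def by (rule mixture_cdf_less_1) (use us_pos us_less in auto)
    then show "us < \<alpha>" using crossing \<alpha> by (simp add: field_simps)
    show "(F has_real_derivative deriv F us) (at us)" using F_diff by (simp add: field_differentiable_derivI)
  qed (use \<alpha> alpha us_pos crossing above F_cont slope in auto)
qed

lemma empirical_counts:
  assumes \<alpha>: "0 \<le> \<alpha>" "\<alpha> \<le> 1"
  shows uniform_count_p: "AE \<omega> in M. eventually (\<lambda>n. \<forall>j\<le>n.
      \<bar>count_le (\<lambda>i. p i \<omega>) n (\<alpha> * j / n) - n * mixture_cdf \<pi> G (\<alpha> * j / n)\<bar> \<le> n powr (3/5)) sequentially"
    and uniform_count_alt: "AE \<omega> in M. eventually (\<lambda>n. \<forall>j\<le>n.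
      \<bar>card {i. i < n \<and> p i \<omega> \<le> \<alpha> * j / n \<and> \<theta> i \<omega>} - n * (\<pi> * G (\<alpha> * j / n))\<bar> \<le> n powr (3/5)) sequentially"
    and count_alt: "AE \<omega> in M. eventually (\<lambda>n. \<bar>card {i. i < n \<and> \<theta> i \<omega>} - n * \<pi>\<bar> \<le> n powr (3/5)) sequentially"
proof -
  note grid = grid_point_in_unit_interval[OF \<alpha>]
  have E1: "expectation (\<lambda>\<omega>. (if P \<omega> then 1 else 0 :: real)\<^sup>2) \<le> 1"
    if [measurable]: "Measurable.pred M P" for P
  proof -
    have "expectation (\<lambda>\<omega>. (if P \<omega> then 1 else 0 :: real)\<^sup>2) = expectation (\<lambda>\<omega>. if P \<omega> then 1 else 0)"
      by (rule Bochner_Integration.integral_cong) auto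
    then show ?thesis by (simp add: expectation_if)
  qed
  have ex: "(1 - 0) / 2 + 1 / 10 = (3 / 5 :: real)" by simp
  have "AE \<omega> in M. eventually (\<lambda>n. \<forall>j\<le>n. \<bar>(\<Sum>i<n. if fst (p i \<omega>, \<theta> i \<omega>) \<le> \<alpha> * j / n then 1 else 0) -
      n * expectation (\<lambda>\<omega>. if fst (p 0 \<omega>, \<theta> 0 \<omega>) \<le> \<alpha> * j / n then 1 else 0)\<bar> \<le> real n powr ((1 - 0) / 2 + 1 / 10)) sequentially"
    by (rule uniform_deviation_functional) (auto intro!: E1)
  then show "AE \<omega> in M. eventually (\<lambda>n. \<forall>j\<le>n.
      \<bar>count_le (\<lambda>i. p i \<omega>) n (\<alpha> * j / n) - n * mixture_cdf \<pi> G (\<alpha> * j / n)\<bar> \<le> n powr (3/5)) sequentially"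
    unfolding ex by eventually_elim (auto elim!: eventually_mono simp: count_le_def card_eq_sum_if expectation_if prob_p_le(2)[OF grid])
  have "AE \<omega> in M. eventually (\<lambda>n. \<forall>j\<le>n. \<bar>(\<Sum>i<n. if fst (p i \<omega>, \<theta> i \<omega>) \<le> \<alpha> * j / n \<and> snd (p i \<omega>, \<theta> i \<omega>) then 1 else 0) -
      n * expectation (\<lambda>\<omega>. if fst (p 0 \<omega>, \<theta> 0 \<omega>) \<le> \<alpha> * j / n \<and> snd (p 0 \<omega>, \<theta> 0 \<omega>) then 1 else 0)\<bar> \<le> real n powr ((1 - 0) / 2 + 1 / 10)) sequentially"
    by (rule uniform_deviation_functional) (auto intro!: E1)
  then show "AE \<omega> in M. eventually (\<lambda>n. \<forall>j\<le>n.
      \<bar>card {i. i < n \<and> p i \<omega> \<le> \<alpha> * j / n \<and> \<theta> i \<omega>} - n * (\<pi> * G (\<alpha> * j / n))\<bar> \<le> n powr (3/5)) sequentially"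
    unfolding ex by eventually_elim (auto elim!: eventually_mono simp: card_eq_sum_if expectation_if prob_p_le(1)[OF grid])
  have "AE \<omega> in M. eventually (\<lambda>n. \<forall>j\<le>n. \<bar>(\<Sum>i<n. if snd (p i \<omega>, \<theta> i \<omega>) then 1 else 0) -
      n * expectation (\<lambda>\<omega>. if snd (p 0 \<omega>, \<theta> 0 \<omega>) then 1 else 0)\<bar> \<le> real n powr ((1 - 0) / 2 + 1 / 10)) sequentially"
    by (rule uniform_deviation_functional) (auto intro!: E1)
  then show "AE \<omega> in M. eventually (\<lambda>n. \<bar>card {i. i < n \<and> \<theta> i \<omega>} - n * \<pi>\<bar> \<le> n powr (3/5)) sequentially"
    unfolding ex by eventually_elim (auto elim!: eventually_mono simp: card_eq_sum_if expectation_if prob_false_null)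
qed

text \<open>
  The increment of the indicator of \<open>p \<le> u\<close> between \<open>us\<close> and a grid point has second moment
  \<open>\<bar>F (\<alpha> j / n) - F us\<bar>\<close>.  Grid points where this exceeds \<open>n\<^sup>-\<^sup>7\<^sup>/\<^sup>2\<^sup>0\<close> are neutralised by replacing the
  summands by 0, so the uniform bound applies with \<open>\<delta> = 7/20\<close>.
\<close>

lemma local_oscillation:
  fixes \<alpha> us :: real and F :: "real \<Rightarrow> real"
  assumes \<alpha>: "0 \<le> \<alpha>" "\<alpha> \<le> 1" and us: "0 \<le> us" "us \<le> 1"
  defines "F \<equiv> mixture_cdf \<pi> G"
  shows "AE \<omega> in M. eventually (\<lambda>n. \<forall>j\<le>n. \<bar>F (\<alpha> * j / n) - F us\<bar> \<le> n powr (-7/20) \<longrightarrow>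
      \<bar>real (count_le (\<lambda>i. p i \<omega>) n (\<alpha> * j / n)) - count_le (\<lambda>i. p i \<omega>) n us - n * (F (\<alpha> * j / n) - F us)\<bar>
        \<le> n powr (17/40)) sequentially"
proof -
  note grid = grid_point_in_unit_interval[OF \<alpha>]
  define I where "I w z = (if fst z \<le> w then 1 else 0 :: real)" for w and z :: "real \<times> bool"
  have I_meas [measurable]: "I w \<in> borel_measurable (borel \<Otimes>\<^sub>M count_space UNIV)" for w
    unfolding I_def by measurable
  have I_int: "integrable M (\<lambda>\<omega>. I w (p 0 \<omega>, \<theta> 0 \<omega>))" for w
    by (rule integrable_const_bound[where B = 1]) (auto simp: I_def)
  have I_exp: "expectation (\<lambda>\<omega>. I w (p 0 \<omega>, \<theta> 0 \<omega>)) = F w" if "w \<in> {0..1}" for w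
    unfolding I_def F_def using that by (simp add: expectation_if prob_p_le(2))
  have diff_exp: "expectation (\<lambda>\<omega>. I w (p 0 \<omega>, \<theta> 0 \<omega>) - I us (p 0 \<omega>, \<theta> 0 \<omega>)) = F w - F us" if "w \<in> {0..1}" for w
    using that us by (simp add: I_int I_exp)
  have diff_sq: "expectation (\<lambda>\<omega>. (I w (p 0 \<omega>, \<theta> 0 \<omega>) - I us (p 0 \<omega>, \<theta> 0 \<omega>))\<^sup>2) = \<bar>F w - F us\<bar>" if "w \<in> {0..1}" for w
  proof (cases "w \<le> us")
    case True
    then have "(I w z - I us z)\<^sup>2 = I us z - I w z" for z by (auto simp: I_def)
    moreover have "F w \<le> F us" unfolding F_def using True that us by (intro mixture_cdf_mono) auto
    ultimately show ?thesis using that us by (simp add: I_int I_exp)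
  next
    case False
    then have "(I w z - I us z)\<^sup>2 = I w z - I us z" for z by (auto simp: I_def)
    moreover have "F us \<le> F w" unfolding F_def using False that us by (intro mixture_cdf_mono) auto
    ultimately show ?thesis using that us by (simp add: I_int I_exp)
  qed
  define near where "near n j \<longleftrightarrow> \<bar>F (\<alpha> * j / n) - F us\<bar> \<le> n powr (-7/20)" for n j :: nat
  define f where "f n j z = (if near n j then I (\<alpha> * j / n) z - I us z else 0)" for n j z
  have ex: "(1 - 7 / 20) / 2 + 1 / 10 = (17 / 40 :: real)" by simp
  have "AE \<omega> in M. eventually (\<lambda>n. \<forall>j\<le>n. \<bar>(\<Sum>i<n. f n j (p i \<omega>, \<theta> i \<omega>)) - n * expectation (\<lambda>\<omega>. f n j (p 0 \<omega>, \<theta> 0 \<omega>))\<bar>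
      \<le> real n powr ((1 - 7 / 20) / 2 + 1 / 10)) sequentially"
  proof (rule uniform_deviation_functional)
    show "f n j \<in> borel_measurable (borel \<Otimes>\<^sub>M count_space UNIV)" for n j unfolding f_def by measurable
    show "\<bar>f n j z\<bar> \<le> 1" for n j z by (simp add: f_def I_def)
    show "expectation (\<lambda>\<omega>. (f n j (p 0 \<omega>, \<theta> 0 \<omega>))\<^sup>2) \<le> real n powr (- (7 / 20))" if "j \<le> n" for n j
      using diff_sq[OF grid[OF that]] by (cases "near n j") (simp_all add: f_def near_def)
  qed auto
  then show ?thesis
    unfolding ex
  proof eventually_elim
    case (elim \<omega>)
    then show ?case
    proof (rule eventually_mono)
      fix n assume *: "\<forall>j\<le>n. \<bar>(\<Sum>i<n. f n j (p i \<omega>, \<theta> i \<omega>)) - n * expectation (\<lambda>\<omega>. f n j (p 0 \<omega>, \<theta> 0 \<omega>))\<bar> \<le> real n powr (17 / 40)"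
      show "\<forall>j\<le>n. \<bar>F (\<alpha> * j / n) - F us\<bar> \<le> n powr (-7/20) \<longrightarrow>
        \<bar>real (count_le (\<lambda>i. p i \<omega>) n (\<alpha> * j / n)) - count_le (\<lambda>i. p i \<omega>) n us - n * (F (\<alpha> * j / n) - F us)\<bar> \<le> n powr (17/40)"
      proof (intro allI impI)
        fix j assume j: "j \<le> n" "\<bar>F (\<alpha> * j / n) - F us\<bar> \<le> n powr (-7/20)"
        then have "near n j" by (simp add: near_def)
        then have f: "f n j = (\<lambda>z. I (\<alpha> * j / n) z - I us z)" by (simp add: f_def fun_eq_iff)
        have "(\<Sum>i<n. I w (p i \<omega>, \<theta> i \<omega>)) = count_le (\<lambda>i. p i \<omega>) n w" for w
          by (simp add: I_def count_le_def card_eq_sum_if)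
        with spec[OF *, of j] j(1) show "\<bar>real (count_le (\<lambda>i. p i \<omega>) n (\<alpha> * j / n)) - count_le (\<lambda>i. p i \<omega>) n us - n * (F (\<alpha> * j / n) - F us)\<bar> \<le> n powr (17/40)"
          unfolding f by (simp add: sum_subtractf diff_exp[OF grid])
      qed
    qed
  qed
qed

lemma lil_count:
  fixes u q :: real
  assumes u: "0 \<le> u" "u \<le> 1" and nondeg: "0 < mixture_cdf \<pi> G u" "mixture_cdf \<pi> G u < 1"
  defines "q \<equiv> mixture_cdf \<pi> G u"
  shows "AE \<omega> in M. limsup (\<lambda>n. ereal ((count_le (\<lambda>i. p i \<omega>) n u - n * q) / sqrt (n * ln (ln n)))) = ereal (sqrt (2 * q * (1 - q)))"
    and "AE \<omega> in M. limsup (\<lambda>n. ereal (- ((count_le (\<lambda>i. p i \<omega>) n u - n * q) / sqrt (n * ln (ln n))))) = ereal (sqrt (2 * q * (1 - q)))"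
proof -
  define f where "f z = (if fst z \<le> u then 1 else 0 :: real)" for z :: "real \<times> bool"
  have f_meas: "f \<in> borel_measurable (borel \<Otimes>\<^sub>M count_space UNIV)" unfolding f_def by measurable
  have f_bound: "\<bar>f z\<bar> \<le> 1" for z by (simp add: f_def)
  have f_exp: "expectation (\<lambda>\<omega>. f (p 0 \<omega>, \<theta> 0 \<omega>)) = q"
    unfolding f_def q_def using u by (simp add: expectation_if prob_p_le(2))
  have sq: "(f z)\<^sup>2 = f z" for z by (simp add: f_def)
  then have v: "bounded_centred_iid.v M (\<lambda>i \<omega>. f (p i \<omega>, \<theta> i \<omega>) - q) = q * (1 - q)"
    using iid_functional(2)[OF f_meas f_bound, unfolded sq f_exp] by (simp add: power2_eq_square algebra_simps)
  interpret Y: bounded_centred_iid M "\<lambda>i \<omega>. f (p i \<omega>, \<theta> i \<omega>) - q" 2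
    using iid_functional(1)[OF f_meas f_bound] by (simp add: f_exp)
  have S: "Y.S n \<omega> = count_le (\<lambda>i. p i \<omega>) n u - n * q" for n \<omega>
    unfolding Y.S_def by (simp add: sum_subtractf f_def count_le_def card_eq_sum_if)
  have pos: "Y.v > 0" unfolding v using nondeg by (simp add: q_def)
  show "AE \<omega> in M. limsup (\<lambda>n. ereal ((count_le (\<lambda>i. p i \<omega>) n u - n * q) / sqrt (n * ln (ln n)))) = ereal (sqrt (2 * q * (1 - q)))"
    using Y.law_of_the_iterated_logarithm[OF pos] by (simp add: S v mult.assoc)
  show "AE \<omega> in M. limsup (\<lambda>n. ereal (- ((count_le (\<lambda>i. p i \<omega>) n u - n * q) / sqrt (n * ln (ln n))))) = ereal (sqrt (2 * q * (1 - q)))"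
    using Y.law_of_the_iterated_logarithm_minus[OF pos] by (simp add: S v mult.assoc)
qed

lemma bh_rejections_measurable [measurable]:
  "(\<lambda>\<omega>. bh_rejections \<alpha> (\<lambda>j. p j \<omega>) n) \<in> M \<rightarrow>\<^sub>M count_space UNIV"
proof -
  have [measurable]: "Measurable.pred M (\<lambda>\<omega>. j \<le> count_le (\<lambda>i. p i \<omega>) n t)" for j t
  proof -
    have "(j \<le> count_le (\<lambda>i. p i \<omega>) n t) = (real j \<le> (\<Sum>i<n. if p i \<omega> \<le> t then 1 else 0))" for \<omega>
      by (simp add: count_le_def flip: card_eq_sum_if)
    then show ?thesis by simp
  qed
  show ?thesis unfolding bh_rejections_eq by measurable
qed

lemma bh_power_measurable [measurable]:
  assumes "0 \<le> \<alpha>"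
  shows "(\<lambda>\<omega>. bh_power \<alpha> (\<lambda>j. p j \<omega>) (\<lambda>j. \<theta> j \<omega>) n) \<in> borel_measurable M"
  unfolding bh_power_eq[OF assms] of_nat_max card_eq_sum_if by measurable

text \<open>
  The numerator of the power is the number of false nulls with p-value below a random threshold
  that belongs to the grid, so the uniform bound applies to it; \<open>\<pi> G\<close> is continuous at \<open>us\<close> because it is
  the difference of \<open>F\<close> and a linear function.
\<close>

lemma bh_power_tendsto:
  assumes "bh_crossing (mixture_cdf \<pi> G) \<alpha> us d"
    and uniform: "eventually (\<lambda>n. \<forall>j\<le>n. \<bar>count_le (\<lambda>i. p i \<omega>) n (\<alpha> * j / n) - n * mixture_cdf \<pi> G (\<alpha> * j / n)\<bar> \<le> n powr (3/5)) sequentially"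
    and alt: "eventually (\<lambda>n. \<forall>j\<le>n. \<bar>card {i. i < n \<and> p i \<omega> \<le> \<alpha> * j / n \<and> \<theta> i \<omega>} - n * (\<pi> * G (\<alpha> * j / n))\<bar> \<le> n powr (3/5)) sequentially"
    and num: "eventually (\<lambda>n. \<bar>card {i. i < n \<and> \<theta> i \<omega>} - n * \<pi>\<bar> \<le> n powr (3/5)) sequentially"
  shows "(\<lambda>n. bh_power \<alpha> (\<lambda>j. p j \<omega>) (\<lambda>j. \<theta> j \<omega>) n) \<longlonglongrightarrow> G us"
proof -
  define F where "F = mixture_cdf \<pi> G"
  interpret bh_crossing F \<alpha> us d using assms(1) by (simp add: F_def)
  let ?x = "\<lambda>i. p i \<omega>"
  note uni = uniform[folded F_def]
  define \<tau> where "\<tau> n = \<alpha> * bh_rejections \<alpha> ?x n / n" for n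
  have \<tau>_lim: "\<tau> \<longlonglongrightarrow> us" using u_tendsto[OF uni] unfolding u_def[OF uni] R_def[OF uni] \<tau>_def[abs_def] .
  have G_eq: "\<pi> * G u = F u - (1 - \<pi>) * u" for u by (simp add: F_def mixture_cdf_def)
  have "(\<lambda>n. F (\<tau> n)) \<longlonglongrightarrow> F us"
    using us_range \<alpha>_range by (intro isCont_tendsto_compose[OF F_isCont \<tau>_lim]) auto
  then have G_lim: "(\<lambda>n. \<pi> * G (\<tau> n)) \<longlonglongrightarrow> \<pi> * G us" unfolding G_eq by (intro tendsto_intros \<tau>_lim)
  have small: "(\<lambda>n. real n powr (-2/5)) \<longlonglongrightarrow> 0" by real_asymp
  have scale: "\<bar>a / n - c\<bar> \<le> real n powr (-2/5)" if "\<bar>a - n * c\<bar> \<le> n powr (3/5)" "n > 0" for a c :: real and n :: nat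
  proof -
    have "a - n * c = n * (a / n - c)" using that(2) by (simp add: right_diff_distrib)
    then have "n * \<bar>a / n - c\<bar> = \<bar>a - n * c\<bar>" by (simp only: abs_mult abs_of_nat)
    also have "\<dots> \<le> n powr (3/5)" by (rule that)
    also have "n powr (3/5) = n * n powr (-2/5)" using powr_add[of "real n" 1 "-2/5"] that by simp
    finally show ?thesis using that(2) by simp
  qed
  define T where "T n = real (card {i. i < n \<and> p i \<omega> \<le> \<tau> n \<and> \<theta> i \<omega>})" for n
  define \<Theta> where "\<Theta> n = real (card {i. i < n \<and> \<theta> i \<omega>})" for n
  have "(\<lambda>n. T n / n - \<pi> * G (\<tau> n)) \<longlonglongrightarrow> 0"
  proof (rule Lim_null_comparison[OF _ small])
    show "eventually (\<lambda>n. norm (T n / n - \<pi> * G (\<tau> n)) \<le> real n powr (-2/5)) sequentially"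
      using alt eventually_gt_at_top[of 0]
    proof eventually_elim
      case (elim n)
      have "bh_rejections \<alpha> ?x n \<le> n" using \<alpha>_range by (intro bh_rejections_le) auto
      with elim show ?case unfolding T_def \<tau>_def real_norm_def by (intro scale) auto
    qed
  qed
  from tendsto_add[OF this G_lim] have T_lim: "(\<lambda>n. T n / n) \<longlonglongrightarrow> \<pi> * G us" by simp
  have "(\<lambda>n. \<Theta> n / n - \<pi>) \<longlonglongrightarrow> 0"
  proof (rule Lim_null_comparison[OF _ small])
    show "eventually (\<lambda>n. norm (\<Theta> n / n - \<pi>) \<le> real n powr (-2/5)) sequentially"
      using num eventually_gt_at_top[of 0]
    proof eventually_elim
      case (elim n)
      then show ?case unfolding \<Theta>_def real_norm_def by (intro scale) auto
    qed
  qed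
  then have \<Theta>_lim: "(\<lambda>n. \<Theta> n / n) \<longlonglongrightarrow> \<pi>" by (rule LIM_zero_cancel)
  have "(\<lambda>n. max (\<Theta> n / n) (1 / n)) \<longlonglongrightarrow> max \<pi> 0"
    by (intro tendsto_max \<Theta>_lim lim_1_over_n)
  then have "(\<lambda>n. (T n / n) / max (\<Theta> n / n) (1 / n)) \<longlonglongrightarrow> (\<pi> * G us) / max \<pi> 0"
    using pi_range by (intro tendsto_divide T_lim) auto
  then have "(\<lambda>n. (T n / n) / max (\<Theta> n / n) (1 / n)) \<longlonglongrightarrow> G us" using pi_range by simp
  moreover have "eventually (\<lambda>n. (T n / n) / max (\<Theta> n / n) (1 / n) = bh_power \<alpha> ?x (\<lambda>j. \<theta> j \<omega>) n) sequentially"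
    using eventually_gt_at_top[of 0]
  proof eventually_elim
    case (elim n)
    have "max (\<Theta> n / n) (1 / n) = max (\<Theta> n) 1 / n" using elim by (simp add: max_def divide_le_cancel)
    then show ?case
      using elim bh_power_eq[of \<alpha> ?x "\<lambda>j. \<theta> j \<omega>" n] \<alpha>_range by (simp add: T_def \<Theta>_def \<tau>_def of_nat_max)
  qed
  ultimately show ?thesis by (rule Lim_transform_eventually)
qed

end

theorem theorem2p2:
  fixes M :: "'a measure" and \<pi> \<alpha> :: real and G :: "real \<Rightarrow> real"
    and p :: "nat \<Rightarrow> 'a \<Rightarrow> real" and \<theta> :: "nat \<Rightarrow> 'a \<Rightarrow> bool"
  defines "F \<equiv> mixture_cdf \<pi> G"
  defines "us \<equiv> u_star F \<alpha>"
  defines "ps \<equiv> p_star F \<alpha>"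
  defines "qs \<equiv> 1 - ps"
  defines "\<Delta> \<equiv> 1 - \<alpha> * deriv F us"
  defines "R \<equiv> \<lambda>n \<omega>. bh_rejections \<alpha> (\<lambda>j. p j \<omega>) n"
  defines "pow \<equiv> \<lambda>n \<omega>. bh_power \<alpha> (\<lambda>j. p j \<omega>) (\<lambda>j. \<theta> j \<omega>) n"
  assumes model: "random_effects_model M \<pi> G p \<theta>"
    and F_cont: "continuous_on {0..1} F"
    and F_0: "F 0 = 0"
    and F_diff: "F field_differentiable (at us)"
    and alpha: "alpha_star F < ereal \<alpha>" "\<alpha> < 1"
    and Delta_pos: "\<Delta> > 0"
  shows "(AE \<omega> in M.
            limsup (\<lambda>n. ereal ((real (R n \<omega>) - real n * ps) / sqrt (real n * ln (ln (real n)))))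
              = ereal (sqrt (2 * ps * qs) / \<Delta>)
          \<and> limsup (\<lambda>n. ereal (- ((real (R n \<omega>) - real n * ps) / sqrt (real n * ln (ln (real n))))))
              = ereal (sqrt (2 * ps * qs) / \<Delta>))
       \<and> prob_space.small_o_p_1 M
            (\<lambda>n \<omega>. pow n \<omega> - real (R n \<omega>) / real n * ((1 - \<alpha>) / \<pi> + \<alpha>))
       \<and> (AE \<omega> in M. (\<lambda>n. pow n \<omega>) \<longlonglongrightarrow> G us)"
proof -
  interpret random_effects_model M \<pi> G p \<theta> by (rule model)
  interpret C: bh_crossing F \<alpha> us "deriv F us"
    unfolding F_def us_def
    by (rule bh_crossing_u_star) (use F_cont F_diff alpha Delta_pos in \<open>simp_all add: F_def us_def \<Delta>_def\<close>)
  have \<alpha>: "0 \<le> \<alpha>" "\<alpha> \<le> 1" and us: "0 \<le> us" "us \<le> 1" using C.\<alpha>_range C.us_range by auto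
  have ps: "F us = ps" by (simp add: ps_def us_def p_star_def)
  have ps_pos: "0 < ps" using C.crossing C.us_range C.\<alpha>_range by (simp add: ps)
  have ps_less: "ps < 1" using C.crossing C.us_range C.\<alpha>_range by (simp add: ps)
  note uniform = uniform_count_p[OF \<alpha>, folded F_def]
  have limsups: "AE \<omega> in M.
            limsup (\<lambda>n. ereal ((real (R n \<omega>) - real n * ps) / sqrt (real n * ln (ln (real n)))))
              = ereal (sqrt (2 * ps * qs) / \<Delta>)
          \<and> limsup (\<lambda>n. ereal (- ((real (R n \<omega>) - real n * ps) / sqrt (real n * ln (ln (real n))))))
              = ereal (sqrt (2 * ps * qs) / \<Delta>)"
    using uniform local_oscillation[OF \<alpha> us, folded F_def]
      lil_count(1)[OF us, folded F_def, unfolded ps, OF ps_pos ps_less]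
      lil_count(2)[OF us, folded F_def, unfolded ps, OF ps_pos ps_less]
  proof eventually_elim
    case (elim \<omega>)
    note uni = elim(1)
    show ?case
      using C.limsup_R[OF uni elim(2), unfolded ps C.R_def[OF uni], OF elim(3,4)]
      by (simp add: R_def \<Delta>_def qs_def)
  qed
  have power: "AE \<omega> in M. (\<lambda>n. pow n \<omega>) \<longlonglongrightarrow> G us"
    using uniform uniform_count_alt[OF \<alpha>] count_alt[OF \<alpha>]
  proof eventually_elim
    case (elim \<omega>)
    show ?case unfolding pow_def
      by (rule bh_power_tendsto[OF C.bh_crossing_axioms[unfolded F_def] elim(1)[unfolded F_def] elim(2,3)])
  qed
  have G_us: "G us = us / \<alpha> * ((1 - \<alpha>) / \<pi> + \<alpha>)"
  proof -
    have "(1 - \<pi>) * us + \<pi> * G us = us / \<alpha>" using C.crossing by (simp add: F_def mixture_cdf_def)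
    then show ?thesis using pi_range C.\<alpha>_range by (simp add: field_simps)
  qed
  have "small_o_p_1 (\<lambda>n \<omega>. pow n \<omega> - real (R n \<omega>) / real n * ((1 - \<alpha>) / \<pi> + \<alpha>))"
  proof (rule AE_tendsto_0_imp_small_o_p_1)
    show "(\<lambda>\<omega>. pow n \<omega> - real (R n \<omega>) / real n * ((1 - \<alpha>) / \<pi> + \<alpha>)) \<in> borel_measurable M" for n
      unfolding pow_def R_def using \<alpha>(1) by measurable
    show "AE \<omega> in M. (\<lambda>n. pow n \<omega> - real (R n \<omega>) / real n * ((1 - \<alpha>) / \<pi> + \<alpha>)) \<longlonglongrightarrow> 0"
      using uniform power
    proof eventually_elim
      case (elim \<omega>)
      have "(\<lambda>n. real (R n \<omega>) / real n) \<longlonglongrightarrow> us / \<alpha>"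
        using C.R_tendsto[OF elim(1)] by (simp add: C.R_def[OF elim(1)] R_def)
      then have "(\<lambda>n. pow n \<omega> - real (R n \<omega>) / real n * ((1 - \<alpha>) / \<pi> + \<alpha>)) \<longlonglongrightarrow> G us - us / \<alpha> * ((1 - \<alpha>) / \<pi> + \<alpha>)"
        by (intro tendsto_diff elim tendsto_mult tendsto_const)
      then show ?case by (simp add: G_us)
    qed
  qed
  with limsups power show ?thesis by blast
qed

end
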